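(* Let $f:S^1\to S^1$ be a homeomorphism whose non-wandering set $NW(f)$ is finite. Then $h_{pol}(C(f))=2$, $h_{pol}(f^{*k})=k$ for every integer $k\ge 1$, and $h_{pol}(2^f)=\infty$.
   Context: **Non-wandering set.** For a continuous map $f:X\to X$ of a compact metric space, a point $p\in X$ is wandering if there is a neighbourhood $U\ni p$ with $f^n(U)\cap U=\emptyset$ for all $n\ge 1$. A point that is not wandering is non-wandering, and $NW(f)$ is the set of non-wandering points. **Hyperspaces.** For a compact metric space $(X,d)$, $2^X$ is the set of all nonempty closed subsets of $X$, with the Hausdorff metric $d_H(A,B)=\inf\{\varepsilon>0 \mid A\subset U(B,\varepsilon),\ B\subset U(A,\varepsilon)\}$, where $U(A,\varepsilon)=\{x\in X\mid d(x,A)<\varepsilon\}$. For $k\in\mathbb{N}$, $k\geq 1$, $X^{*k}\subset 2^X$ is the subspace of all nonempty subsets of $X$ with at most $k$ points. If $X$ is connected, $C(X)\subset 2^X$ is the subspace of all nonempty closed connected subsets of $X$ (one-point sets and $X$ itself are included). All of these carry the metric $d_H$. **Induced maps.** A continuous $f:X\to X$ induces continuous maps $2^f:2^X\to 2^X$, $C(f):C(X)\to C(X)$ and $f^{*k}:X^{*k}\to X^{*k}$, each given by $A\mapsto f(A)=\{f(x)\mid x\in A\}$. **Polynomial entropy.** For a continuous map $g:Z\to Z$ of a compact metric space $(Z,d)$, let $d_n^g(x,y)=\max_{0\le j\le n-1}d(g^j(x),g^j(y))$. A finite set $E\subset Z$ is $(n,\varepsilon)$-separated if $d_n^g(x,y)\ge\varepsilon$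 for all distinct $x,y\in E$. Let $S(n,\varepsilon;Z)$ be the maximal cardinality of an $(n,\varepsilon)$-separated subset of $Z$. Then $$h_{pol}(g)=\lim_{\varepsilon\to 0}\limsup_{n\to\infty}\frac{\log S(n,\varepsilon;Z)}{\log n}.$$ The circle $S^1$ carries its usual metric ($h_{pol}$ depends only on the topology, not on the choice of compatible metric). *)

theory Defs
  imports "HOL-Analysis.Analysis"
begin

definition wandering :: "'a::metric_space set \<Rightarrow> ('a \<Rightarrow> 'a) \<Rightarrow> 'a \<Rightarrow> bool" where
  "wandering X f p \<longleftrightarrow>
     (\<exists>U. openin (top_of_set X) U \<and> p \<in> U \<and> (\<forall>n\<ge>1. (f ^^ n) ` U \<inter> U = {}))"

definition nonwandering_set :: "'a::metric_space set \<Rightarrow> ('a \<Rightarrow> 'a) \<Rightarrow> 'a set" where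
  "nonwandering_set X f = {p \<in> X. \<not> wandering X f p}"

definition closed_hyperspace :: "'a::metric_space set \<Rightarrow> 'a set set" where
  "closed_hyperspace X = {A. closedin (top_of_set X) A \<and> A \<noteq> {}}"

definition continuum_hyperspace :: "'a::metric_space set \<Rightarrow> 'a set set" where
  "continuum_hyperspace X = {A \<in> closed_hyperspace X. connected A}"

definition finite_hyperspace :: "nat \<Rightarrow> 'a::metric_space set \<Rightarrow> 'a set set" where
  "finite_hyperspace k X = {A. A \<subseteq> X \<and> A \<noteq> {} \<and> finite A \<and> card A \<le> k}"

definition metric_nbhd :: "'a::metric_space set \<Rightarrow> 'a set \<Rightarrow> real \<Rightarrow> 'a set" where
  "metric_nbhd X A \<epsilon> = {x \<in> X. infdist x A < \<epsilon>}"

text \<open>Only meaningful for nonempty bounded \<open>A, B \<subseteq> X\<close>: \<open>infdist x {} = 0\<close>, and \<open>Inf\<close> is taken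
  in the reals.\<close>

definition hausdorff_dist :: "'a::metric_space set \<Rightarrow> 'a set \<Rightarrow> 'a set \<Rightarrow> real" where
  "hausdorff_dist X A B = Inf {\<epsilon>. \<epsilon> > 0 \<and> A \<subseteq> metric_nbhd X B \<epsilon> \<and> B \<subseteq> metric_nbhd X A \<epsilon>}"

text \<open>Polynomial entropy is defined for a carrier \<open>Z\<close> with an explicit metric \<open>d\<close>, so that it applies
  to hyperspaces, whose points are sets and carry no type-class metric. \<open>Max\<close> is the actual maximum
  whenever \<open>Z\<close> is compact and \<open>g\<close> continuous with respect to \<open>d\<close>, because then the cardinalities
  of separated sets are bounded. The values at \<open>n = 0\<close> and \<open>n = 1\<close> (where \<open>ln (real n) = 0\<close>) are
  irrelevant for the \<open>limsup\<close>.\<close>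

definition dyn_dist :: "('z \<Rightarrow> 'z \<Rightarrow> real) \<Rightarrow> ('z \<Rightarrow> 'z) \<Rightarrow> nat \<Rightarrow> 'z \<Rightarrow> 'z \<Rightarrow> real" where
  "dyn_dist d g n x y = Max ((\<lambda>j. d ((g ^^ j) x) ((g ^^ j) y)) ` {..<n})"

definition separated_set ::
  "'z set \<Rightarrow> ('z \<Rightarrow> 'z \<Rightarrow> real) \<Rightarrow> ('z \<Rightarrow> 'z) \<Rightarrow> nat \<Rightarrow> real \<Rightarrow> 'z set \<Rightarrow> bool" where
  "separated_set Z d g n \<epsilon> E \<longleftrightarrow>
     finite E \<and> E \<subseteq> Z \<and> (\<forall>x\<in>E. \<forall>y\<in>E. x \<noteq> y \<longrightarrow> dyn_dist d g n x y \<ge> \<epsilon>)"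

definition max_separated ::
  "'z set \<Rightarrow> ('z \<Rightarrow> 'z \<Rightarrow> real) \<Rightarrow> ('z \<Rightarrow> 'z) \<Rightarrow> nat \<Rightarrow> real \<Rightarrow> nat" where
  "max_separated Z d g n \<epsilon> = Max {card E |E. separated_set Z d g n \<epsilon> E}"

definition pol_entropy :: "'z set \<Rightarrow> ('z \<Rightarrow> 'z \<Rightarrow> real) \<Rightarrow> ('z \<Rightarrow> 'z) \<Rightarrow> ereal" where
  "pol_entropy Z d g =
     Lim (at_right (0::real))
       (\<lambda>\<epsilon>. limsup (\<lambda>n. ereal (ln (real (max_separated Z d g n \<epsilon>)) / ln (real n))))"

end

theory Submission
  imports Defs "HOL-Real_Asymp.Real_Asymp"
begin

text \<open>The upper bounds hold for every circle homeomorphism. Cut the circle at the preimages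
  \<open>f\<^sup>-\<^sup>j(Q)\<close>, \<open>j < n\<close>, of a finite net \<open>Q\<close>: the arcs between these \<open>O(n)\<close> points stay small up to time
  \<open>n\<close>, so up to a small error a set with at most \<open>k\<close> points is described by \<open>k\<close> of \<open>O(n)\<close> codes and an
  arc by two.

  For the lower bounds only one wandering point \<open>p\<close> is needed, and it exists because the circle is
  infinite. The point \<open>x\<^sub>j = f\<^sup>-\<^sup>j(p)\<close> visits a neighbourhood of \<open>p\<close> at time \<open>j\<close> only. If two subsets of
  \<open>{x\<^sub>0, \<dots>, x\<^sub>n\<^sub>-\<^sub>1}\<close> differ in \<open>x\<^sub>j\<close>, then at time \<open>j\<close> exactly one of them meets that neighbourhood.
  If \<open>x\<^sub>j\<close> is an endpoint of one arc but not of another one with endpoints among the \<open>x\<^sub>i\<close>, then at time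
  \<open>j\<close> the second arc contains the whole neighbourhood or misses it, while the first one does
  neither. This gives \<open>n choose k\<close>, \<open>2\<^sup>n - 1\<close> and \<open>n choose 2\<close> separated elements, respectively.\<close>

subsection \<open>Separated sets and growth rates\<close>

text \<open>A coding whose fibres have small dynamical diameter keeps \<^const>\<open>max_separated\<close> from being
  the maximum of an infinite set.\<close>

lemma separated_card_le_codes:
  assumes "finite K" "\<iota> ` Z \<subseteq> K"
    and code: "\<And>A B. \<lbrakk>A \<in> Z; B \<in> Z; \<iota> A = \<iota> B\<rbrakk> \<Longrightarrow> dyn_dist d g n A B < \<epsilon>"
    and "separated_set Z d g n \<epsilon> E"
  shows "card E \<le> card K"
proof (rule card_inj_on_le)
  show "inj_on \<iota> E"
    using assms(4) code unfolding separated_set_def inj_on_def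
    by (meson in_mono linorder_not_less)
  show "\<iota> ` E \<subseteq> K" "finite K"
    using assms(1,2,4) unfolding separated_set_def by blast+
qed

lemma max_separated_le_codes:
  assumes "finite K" "\<iota> ` Z \<subseteq> K"
    and code: "\<And>A B. \<lbrakk>A \<in> Z; B \<in> Z; \<iota> A = \<iota> B\<rbrakk> \<Longrightarrow> dyn_dist d g n A B < \<epsilon>"
  shows "max_separated Z d g n \<epsilon> \<le> card K"
proof -
  have *: "c \<le> card K" if "c \<in> {card E |E. separated_set Z d g n \<epsilon> E}" for c
    using separated_card_le_codes[OF assms] that by blast
  have "separated_set Z d g n \<epsilon> {}"
    unfolding separated_set_def by simp
  then have "{card E |E. separated_set Z d g n \<epsilon> E} \<noteq> {}"
    by blast
  moreover have "finite {card E |E. separated_set Z d g n \<epsilon> E}"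
    by (rule finite_subset[of _ "{..card K}"]) (use * in auto)
  ultimately show ?thesis
    unfolding max_separated_def by (intro Max.boundedI *)
qed

text \<open>The coding matters for a lower bound too: it bounds the cardinalities of separated sets,
  so \<open>Max\<close> is a genuine maximum and dominates the family exhibited.\<close>

lemma card_le_max_separated:
  assumes "finite K" "\<iota> ` Z \<subseteq> K"
    and code: "\<And>A B. \<lbrakk>A \<in> Z; B \<in> Z; \<iota> A = \<iota> B\<rbrakk> \<Longrightarrow> dyn_dist d g n A B < \<epsilon>"
    and "finite L" "a ` L \<subseteq> Z"
    and sep: "\<And>i j. \<lbrakk>i \<in> L; j \<in> L; i \<noteq> j\<rbrakk> \<Longrightarrow> \<epsilon> \<le> dyn_dist d g n (a i) (a j)"
  shows "card L \<le> max_separated Z d g n \<epsilon>"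
proof -
  \<comment> \<open>If \<open>a i = a j\<close>, separation puts this point at dynamical distance at
    least \<epsilon> from itself, while the coding with both arguments equal gives less than
    \<epsilon>.\<close>
  have inj: "inj_on a L"
  proof (rule inj_onI, rule ccontr)
    fix i j assume ij: "i \<in> L" "j \<in> L" "a i = a j" "i \<noteq> j"
    then show False
      using sep[OF ij(1,2,4)] code[of "a i" "a j"] assms(5) by force
  qed
  have "separated_set Z d g n \<epsilon> (a ` L)"
    using assms(4,5) sep unfolding separated_set_def by auto
  then have "card (a ` L) \<in> {card E |E. separated_set Z d g n \<epsilon> E}"
    by blast
  moreover have "finite {card E |E. separated_set Z d g n \<epsilon> E}"
  proof (rule finite_subset)
    show "{card E |E. separated_set Z d g n \<epsilon> E} \<subseteq> {..card K}"
      using separated_card_le_codes[OF assms(1,2) code] by blast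
  qed simp
  ultimately show ?thesis
    unfolding max_separated_def by (simp add: card_image[OF inj])
qed

section \<open>From growth rates of separated sets to polynomial entropy\<close>

lemma pol_entropy_eqI_eventually:
  assumes "\<epsilon>\<^sub>0 > 0"
    and "\<And>\<epsilon>. \<lbrakk>0 < \<epsilon>; \<epsilon> < \<epsilon>\<^sub>0\<rbrakk> \<Longrightarrow>
      limsup (\<lambda>n. ereal (ln (real (max_separated Z d g n \<epsilon>)) / ln (real n))) = l"
  shows "pol_entropy Z d g = l"
  unfolding pol_entropy_def
proof (rule tendsto_Lim)
  \<comment> \<open>The limsup is the same for every small \<epsilon>, so the limit is that of an
    eventually constant function.\<close>
  have "\<forall>\<^sub>F \<epsilon> in at_right 0. limsup (\<lambda>n. ereal (ln (real (max_separated Z d g n \<epsilon>)) / ln (real n))) = l"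
    using eventually_at_right_real[OF assms(1)] by eventually_elim (use assms(2) in auto)
  then show "((\<lambda>\<epsilon>. limsup (\<lambda>n. ereal (ln (real (max_separated Z d g n \<epsilon>)) / ln (real n)))) \<longlongrightarrow> l) (at_right 0)"
    by (rule tendsto_eventually)
qed simp

text \<open>After taking logarithms the factors \<open>a\<close> and \<open>b\<close> are additive
  constants, and division by \<open>ln n\<close> removes them. They may therefore depend on
  \<epsilon>.\<close>

lemma pol_entropy_polynomial:
  assumes "\<epsilon>\<^sub>0 > 0"
    and "\<And>\<epsilon>. \<lbrakk>0 < \<epsilon>; \<epsilon> < \<epsilon>\<^sub>0\<rbrakk> \<Longrightarrow> \<exists>a b::real. 0 < a \<and>
      (\<forall>\<^sub>F n in sequentially. a * real n ^ k \<le> max_separated Z d g n \<epsilon> \<and>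
         max_separated Z d g n \<epsilon> \<le> b * real n ^ k)"
  shows "pol_entropy Z d g = ereal (real k)"
proof (rule pol_entropy_eqI_eventually[OF assms(1)])
  fix \<epsilon> :: real assume "0 < \<epsilon>" "\<epsilon> < \<epsilon>\<^sub>0"
  then obtain a b :: real where "0 < a"
    and ev: "\<forall>\<^sub>F n in sequentially. a * real n ^ k \<le> max_separated Z d g n \<epsilon> \<and>
         max_separated Z d g n \<epsilon> \<le> b * real n ^ k"
    using assms(2) by blast
  have lim: "(\<lambda>n. (ln c + real k * ln (real n)) / ln (real n)) \<longlonglongrightarrow> real k" for c :: real
  proof -
    have "(\<lambda>n. ln c * (1 / ln (real n)) + real k) \<longlonglongrightarrow> ln c * 0 + real k"
      by (intro tendsto_intros) real_asymp
    moreover have "\<forall>\<^sub>F n in sequentially. ln c * (1 / ln (real n)) + real k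
        = (ln c + real k * ln (real n)) / ln (real n)"
      using eventually_gt_at_top[of 1] by eventually_elim (simp add: field_simps)
    ultimately show ?thesis
      by (simp add: tendsto_cong)
  qed
  have "(\<lambda>n. ln (real (max_separated Z d g n \<epsilon>)) / ln (real n)) \<longlonglongrightarrow> real k"
  proof (rule tendsto_sandwich[OF _ _ lim[of a] lim[of b]])
    show "\<forall>\<^sub>F n in sequentially. (ln a + real k * ln (real n)) / ln (real n)
        \<le> ln (real (max_separated Z d g n \<epsilon>)) / ln (real n)"
      using ev eventually_gt_at_top[of 1]
    proof eventually_elim
      case (elim n)
      then have "0 < a * real n ^ k"
        using \<open>0 < a\<close> by simp
      then have "ln (a * real n ^ k) \<le> ln (real (max_separated Z d g n \<epsilon>))"
        using elim by (intro ln_mono) auto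
      then show ?case
        using elim \<open>0 < a\<close> by (simp add: ln_mult ln_realpow divide_right_mono)
    qed
    show "\<forall>\<^sub>F n in sequentially. ln (real (max_separated Z d g n \<epsilon>)) / ln (real n)
        \<le> (ln b + real k * ln (real n)) / ln (real n)"
      using ev eventually_gt_at_top[of 1]
    proof eventually_elim
      case (elim n)
      \<comment> \<open>The sign of \<open>b\<close> is not assumed. It follows from the lower
        bound, since \<open>b * n ^ k\<close> dominates a positive quantity.\<close>
      have "0 < a * real n ^ k"
        using elim \<open>0 < a\<close> by simp
      then have pos: "0 < real (max_separated Z d g n \<epsilon>)"
        using elim by linarith
      then have "0 < b * real n ^ k"
        using elim by linarith
      then have "0 < b"
        using elim by (simp add: zero_less_mult_iff)
      then have "ln (real (max_separated Z d g n \<epsilon>)) \<le> ln (b * real n ^ k)"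
        using elim pos by (intro ln_mono) auto
      then show ?case
        using elim \<open>0 < b\<close> by (simp add: ln_mult ln_realpow divide_right_mono)
    qed
  qed
  then have "(\<lambda>n. ereal (ln (real (max_separated Z d g n \<epsilon>)) / ln (real n))) \<longlonglongrightarrow> ereal (real k)"
    by (rule tendsto_ereal)
  then show "limsup (\<lambda>n. ereal (ln (real (max_separated Z d g n \<epsilon>)) / ln (real n))) = ereal (real k)"
    by (rule lim_imp_Limsup[rotated]) simp
qed

lemma pol_entropy_exponential:
  assumes "\<epsilon>\<^sub>0 > 0"
    and "\<And>\<epsilon>. \<lbrakk>0 < \<epsilon>; \<epsilon> < \<epsilon>\<^sub>0\<rbrakk> \<Longrightarrow> \<forall>\<^sub>F n in sequentially. 2 ^ n - 1 \<le> max_separated Z d g n \<epsilon>"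
  shows "pol_entropy Z d g = \<infinity>"
proof (rule pol_entropy_eqI_eventually[OF assms(1)])
  fix \<epsilon> :: real assume "0 < \<epsilon>" "\<epsilon> < \<epsilon>\<^sub>0"
  then have ev: "\<forall>\<^sub>F n in sequentially. 2 ^ n - 1 \<le> max_separated Z d g n \<epsilon>"
    by (rule assms(2))
  have "filterlim (\<lambda>n::nat. ln (2 ^ n - 1) / ln (real n)) at_top sequentially"
    by real_asymp
  then have "filterlim (\<lambda>n. ln (real (max_separated Z d g n \<epsilon>)) / ln (real n)) at_top sequentially"
  proof (rule filterlim_at_top_mono)
    show "\<forall>\<^sub>F n in sequentially. ln (2 ^ n - 1) / ln (real n)
        \<le> ln (real (max_separated Z d g n \<epsilon>)) / ln (real n)"
      using ev eventually_gt_at_top[of 1]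
    proof eventually_elim
      case (elim n)
      \<comment> \<open>The subtraction in the hypothesis is one of natural numbers; it becomes the
        real one because \<open>2 ^ n\<close> is at least 1.\<close>
      have "real (2 ^ n - 1) \<le> real (max_separated Z d g n \<epsilon>)"
        using elim(1) of_nat_le_iff by blast
      then have "2 ^ n - 1 \<le> real (max_separated Z d g n \<epsilon>)"
        by (simp add: of_nat_diff)
      moreover have "(1::real) < 2 ^ n"
        using elim(2) by (intro one_less_power) auto
      ultimately have "ln (2 ^ n - 1) \<le> ln (real (max_separated Z d g n \<epsilon>))"
        by (intro ln_mono) linarith+
      then show ?case
        using elim(2) by (intro divide_right_mono) auto
    qed
  qed
  then have "(\<lambda>n. ereal (ln (real (max_separated Z d g n \<epsilon>)) / ln (real n))) \<longlonglongrightarrow> \<infinity>"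
    by (simp add: tendsto_PInfty_eq_at_top)
  then show "limsup (\<lambda>n. ereal (ln (real (max_separated Z d g n \<epsilon>)) / ln (real n))) = \<infinity>"
    by (rule lim_imp_Limsup[rotated]) simp
qed

subsection \<open>Hausdorff distance along orbits\<close>

lemma hausdorff_dist_less:
  assumes "A \<subseteq> X" "B \<subseteq> X" "0 < \<epsilon>"
    and "\<And>a. a \<in> A \<Longrightarrow> \<exists>b\<in>B. dist a b < \<epsilon> / 2" "\<And>b. b \<in> B \<Longrightarrow> \<exists>a\<in>A. dist b a < \<epsilon> / 2"
  shows "hausdorff_dist X A B < \<epsilon>"
proof -
  have nbhd: "C \<subseteq> metric_nbhd X D \<delta>"
    if "C \<subseteq> X" "\<And>c. c \<in> C \<Longrightarrow> \<exists>e\<in>D. dist c e < \<delta>" for C D \<delta>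
    unfolding metric_nbhd_def using that le_less_trans[OF infdist_le] by blast
  \<comment> \<open>The halved radius is itself admissible in the infimum, which turns a weak bound
    by \<epsilon>/2 into a strict one by \<epsilon>.\<close>
  have "A \<subseteq> metric_nbhd X B (\<epsilon> / 2)" "B \<subseteq> metric_nbhd X A (\<epsilon> / 2)"
    using nbhd assms by simp_all
  then have "\<epsilon> / 2 \<in> {\<epsilon>. \<epsilon> > 0 \<and> A \<subseteq> metric_nbhd X B \<epsilon> \<and> B \<subseteq> metric_nbhd X A \<epsilon>}"
    using assms(3) by simp
  then have "hausdorff_dist X A B \<le> \<epsilon> / 2"
    unfolding hausdorff_dist_def by (intro cInf_lower bdd_belowI[of _ 0]) auto
  then show ?thesis
    using assms(3) by simp
qed

lemma hausdorff_dist_commute: "hausdorff_dist X A B = hausdorff_dist X B A"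
  unfolding hausdorff_dist_def by (rule arg_cong[where f = Inf]) blast

text \<open>A point of \<open>A\<close> with no point of \<open>B\<close> within \<open>r\<close>
  excludes every admissible radius below \<open>r\<close>. Boundedness of \<open>X\<close> provides
  some admissible radius, without which the real \<open>Inf\<close> would say nothing.\<close>

lemma hausdorff_dist_ge:
  assumes "A \<subseteq> X" "B \<subseteq> X" "B \<noteq> {}" "bounded X" "a \<in> A" "ball a r \<inter> B = {}"
  shows "r \<le> hausdorff_dist X A B"
  unfolding hausdorff_dist_def
proof (rule cInf_greatest)
  obtain D where D: "\<And>x y. x \<in> X \<Longrightarrow> y \<in> X \<Longrightarrow> dist x y \<le> D"
    using \<open>bounded X\<close> bounded_two_points by metis
  have lt: "infdist x C < D + 1" if "x \<in> X" "C \<subseteq> X" "C \<noteq> {}" for x C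
  proof -
    obtain c where "c \<in> C"
      using \<open>C \<noteq> {}\<close> by blast
    then have "infdist x C \<le> D"
      using infdist_le2 D that by blast
    then show ?thesis
      by simp
  qed
  have "0 < D + 1"
    using lt[of a B] assms infdist_nonneg[of a B] by force
  moreover have "A \<subseteq> metric_nbhd X B (D + 1)" "B \<subseteq> metric_nbhd X A (D + 1)"
    using assms lt unfolding metric_nbhd_def by blast+
  ultimately have "D + 1 \<in> {\<epsilon>. \<epsilon> > 0 \<and> A \<subseteq> metric_nbhd X B \<epsilon> \<and> B \<subseteq> metric_nbhd X A \<epsilon>}"
    by simp
  then show "{\<epsilon>. \<epsilon> > 0 \<and> A \<subseteq> metric_nbhd X B \<epsilon> \<and> B \<subseteq> metric_nbhd X A \<epsilon>} \<noteq> {}"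
    by blast
next
  fix \<epsilon> assume "\<epsilon> \<in> {\<epsilon>. \<epsilon> > 0 \<and> A \<subseteq> metric_nbhd X B \<epsilon> \<and> B \<subseteq> metric_nbhd X A \<epsilon>}"
  then have "infdist a B < \<epsilon>"
    using assms(5) unfolding metric_nbhd_def by auto
  moreover have "r \<le> infdist a B"
    unfolding infdist_notempty[OF \<open>B \<noteq> {}\<close>]
    by (rule cINF_greatest[OF \<open>B \<noteq> {}\<close>]) (use assms(6) in force)
  ultimately show "r \<le> \<epsilon>"
    by simp
qed

lemma funpow_image:
  fixes f :: "'a \<Rightarrow> 'a"
  shows "((\<lambda>A. f ` A) ^^ n) A = (f ^^ n) ` A"
  by (induction n) (auto simp: image_comp)

lemma dyn_dist_less:
  assumes "n \<ge> 1" "\<And>j. j < n \<Longrightarrow> d ((g ^^ j) x) ((g ^^ j) y) < \<epsilon>"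
  shows "dyn_dist d g n x y < \<epsilon>"
proof -
  have "{..<n} \<noteq> {}"
    using assms(1) by (metis One_nat_def Suc_le_eq empty_iff lessThan_iff)
  then show ?thesis
    unfolding dyn_dist_def using assms(2) by simp
qed

lemma le_dyn_dist:
  assumes "j < n" "\<epsilon> \<le> d ((g ^^ j) x) ((g ^^ j) y)"
  shows "\<epsilon> \<le> dyn_dist d g n x y"
proof -
  have "d ((g ^^ j) x) ((g ^^ j) y) \<le> dyn_dist d g n x y"
    unfolding dyn_dist_def using assms(1) by (intro Max_ge) auto
  then show ?thesis
    using assms(2) by simp
qed

lemma homeomorphism_funpow:
  assumes "homeomorphism S S f g"
  shows "homeomorphism S S (f ^^ n) (g ^^ n)"
proof (induction n)
  case 0
  then show ?case
    by (simp add: homeomorphism_def)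
next
  case (Suc n)
  show ?case
    \<comment> \<open>The new factor is split off on the left for \<open>f\<close> and on the right
      for \<open>g\<close>, matching the order in which inverses compose.\<close>
    unfolding funpow.simps(2)[of n f] funpow_Suc_right[of n g]
    by (rule homeomorphism_compose[OF Suc assms])
qed

subsection \<open>The circle\<close>

lemma cis_Arg2pi: "norm z = 1 \<Longrightarrow> cis (Arg2pi z) = z"
  using complex_norm_eq_1_exp[of z] by (simp add: cis_conv_exp)

lemma Arg2pi_cis: "\<lbrakk>0 \<le> t; t < 2 * pi\<rbrakk> \<Longrightarrow> Arg2pi (cis t) = t"
  by (rule Arg2pi_unique[of 1]) (auto simp: cis_conv_exp)

text \<open>Both \<open>\<bar>s - t\<bar>\<close> and 0 lie in [0, 2 pi), where
  \<open>Arg2pi\<close> inverts \<open>cis\<close>, and both are sent to 1.\<close>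

lemma cis_eq_imp_eq:
  assumes "cis s = cis t" "\<bar>s - t\<bar> < 2 * pi"
  shows "s = t"
proof -
  have "cis \<bar>s - t\<bar> = 1"
  proof (cases "s \<le> t")
    case True
    then have "cis \<bar>s - t\<bar> = cis t / cis s"
      by (simp add: cis_divide)
    then show ?thesis
      using assms(1) by simp
  next
    case False
    then have "cis \<bar>s - t\<bar> = cis s / cis t"
      by (simp add: cis_divide)
    then show ?thesis
      using assms(1) by simp
  qed
  then show ?thesis
    using Arg2pi_cis[of "\<bar>s - t\<bar>"] Arg2pi_cis[of 0] assms(2) by simp
qed

lemma cis_add_2pi: "cis (t + 2 * pi) = cis t"
  using cis_mult[of t "2 * pi"] by simp

lemma circle_eq_cis_image: "sphere 0 1 = cis ` {s..<s + 2 * pi}"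
proof (intro equalityI subsetI)
  fix z :: complex assume z: "z \<in> sphere 0 1"
  define t where "t = s + Arg2pi (z / cis s)"
  have "cis t = cis s * (z / cis s)"
    using z by (simp add: t_def cis_Arg2pi norm_divide flip: cis_mult)
  moreover have "t \<in> {s..<s + 2 * pi}"
    using Arg2pi[of "z / cis s"] by (auto simp: t_def)
  ultimately show "z \<in> cis ` {s..<s + 2 * pi}"
    by (auto intro!: image_eqI[of _ _ t])
qed auto

lemma cis_image_Un_complement:
  assumes "s \<le> t" "t \<le> s + 2 * pi"
  shows "sphere 0 1 = cis ` {s..t} \<union> cis ` {t..s + 2 * pi}"
proof -
  have "cis ` {s..s + 2 * pi} = sphere 0 1"
    using circle_eq_cis_image[of s] by auto
  moreover have "{s..s + 2 * pi} = {s..t} \<union> {t..s + 2 * pi}"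
    using assms by auto
  ultimately show ?thesis
    by (simp flip: image_Un)
qed

lemma compact_cis_image: "compact (cis ` {s..t})"
  by (intro compact_continuous_image continuous_intros) auto

lemma connected_cis_image: "connected S \<Longrightarrow> connected (cis ` S)"
  by (intro connected_continuous_image continuous_intros)

text \<open>Every angle in the interval differs from \<open>u\<close> by less than a full turn. This
  separates an arc from the interior of its complement.\<close>

lemma cis_image_disjoint:
  assumes "cis u \<in> cis ` {s..t}" "t < u" "u < s + 2 * pi"
  shows False
proof -
  obtain v where "v \<in> {s..t}" "cis u = cis v"
    using assms(1) by blast
  then have "u = v"
    using assms by (intro cis_eq_imp_eq) auto
  then show False
    using assms \<open>v \<in> {s..t}\<close> by auto
qed

text \<open>The complement of the open arc is the closed arc from \<open>t\<close> on to
  \<open>s + 2 * pi\<close>, which is compact.\<close>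

lemma openin_cis_image:
  assumes "t \<le> s + 2 * pi"
  shows "openin (top_of_set (sphere 0 1)) (cis ` {s<..<t})"
proof (cases "s < t")
  case True
  have "cis ` {s<..<t} = sphere 0 1 - cis ` {t..s + 2 * pi}"
  proof (intro equalityI subsetI)
    fix z assume "z \<in> cis ` {s<..<t}"
    then obtain u where u: "z = cis u" "s < u" "u < t"
      by auto
    \<comment> \<open>One full turn moves the angle to the right of the closed interval, where
      \<open>cis_image_disjoint\<close> applies.\<close>
    have "cis (u + 2 * pi) \<notin> cis ` {t..s + 2 * pi}"
      using cis_image_disjoint[of "u + 2 * pi" t "s + 2 * pi"] u by auto
    then show "z \<in> sphere 0 1 - cis ` {t..s + 2 * pi}"
      using u by (simp add: cis_add_2pi)
  next
    fix z assume z: "z \<in> sphere 0 1 - cis ` {t..s + 2 * pi}"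
    then obtain u where u: "z = cis u" "u \<in> {s..<s + 2 * pi}"
      using circle_eq_cis_image[of s] by blast
    have "u < t"
      using z u by (metis Diff_iff atLeastAtMost_iff atLeastLessThan_iff image_eqI less_eq_real_def not_le)
    moreover have "u \<noteq> s"
    proof
      assume "u = s"
      then have "z = cis (s + 2 * pi)"
        using u by (simp add: cis_add_2pi)
      then show False
        using z assms by auto
    qed
    ultimately show "z \<in> cis ` {s<..<t}"
      using u by auto
  qed
  moreover have "closedin (top_of_set (sphere 0 1)) (cis ` {t..s + 2 * pi})"
    by (rule closed_subset) (auto simp: compact_cis_image compact_imp_closed)
  ultimately show ?thesis
    by (simp add: openin_diff)
qed auto

lemma dist_cis_le: "dist (cis s) (cis t) \<le> \<bar>s - t\<bar>"
proof -
  have "cis s - cis t = cis t * (cis (s - t) - 1)"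
    by (simp add: algebra_simps cis_mult)
  then have "dist (cis s) (cis t) = norm (cis (s - t) - 1)"
    by (simp add: dist_norm norm_mult)
  also have "\<dots> = 2 * \<bar>sin ((s - t) / 2)\<bar>"
    using dist_exp_i_1[of "s - t"] by (simp add: cis_conv_exp)
  also have "\<dots> \<le> \<bar>s - t\<bar>"
    using abs_sin_x_le_abs_x[of "(s - t) / 2"] by simp
  finally show ?thesis .
qed

text \<open>Allowing angles up to \<open>4\<pi>\<close> represents every arc by one interval, wherever it starts.\<close>

lemma continuum_eq_cis_image:
  assumes "A \<in> continuum_hyperspace (sphere 0 1)"
  obtains s t where "0 \<le> s" "s \<le> t" "t < 4 * pi" "A = cis ` {s..t}"
proof (cases "A = sphere 0 1")
  case True
  have "A = cis ` {0..2 * pi}"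
    using circle_eq_cis_image[of 0] True by auto
  then show ?thesis
    using that[of 0 "2 * pi"] by simp
next
  case False
  have A: "connected A" "A \<noteq> {}" "A \<subseteq> sphere 0 1" and cl: "closedin (top_of_set (sphere 0 1)) A"
    using assms by (auto simp: continuum_hyperspace_def closed_hyperspace_def closedin_def)
  have "compact A"
    using cl by (meson closedin_compact compact_sphere)
  obtain q where q: "norm q = 1" "q \<notin> A"
    using False A by auto
  \<comment> \<open>Angles are measured from a point \<open>q\<close> missed by \<open>A\<close>.
    The branch cut of \<open>h\<close> then lies outside \<open>A\<close>, so \<open>h\<close> is a
    continuous angle on \<open>A\<close>, with values in [\<theta>, \<theta> + 2 pi), and maps
    \<open>A\<close> onto a compact interval.\<close>
  define \<theta> where "\<theta> = Arg2pi q"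
  define h where "h = (\<lambda>z. \<theta> + Arg2pi (z / q))"
  have q_eq: "q = cis \<theta>"
    using q by (simp add: \<theta>_def cis_Arg2pi)
  have cis_h: "cis (h z) = z" if "z \<in> A" for z
    using that A(3) q by (auto simp: h_def cis_Arg2pi norm_divide q_eq simp flip: cis_mult)
  have nonneg: "z / q \<notin> \<real>\<^sub>\<ge>\<^sub>0" if "z \<in> A" for z
  proof
    assume "z / q \<in> \<real>\<^sub>\<ge>\<^sub>0"
    then obtain r where r: "z / q = of_real r" "0 \<le> r"
      by (auto elim: nonneg_Reals_cases)
    have "norm (z / q) = 1"
      using that A(3) q by (auto simp: norm_divide)
    then have "r = 1"
      using r by simp
    then show False
      using r q that by (auto simp: divide_eq_eq split: if_splits)
  qed
  have "continuous_on A h"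
  proof -
    have "continuous_on (- \<real>\<^sub>\<ge>\<^sub>0) Arg2pi"
      by (simp add: continuous_at_Arg2pi continuous_at_imp_continuous_on)
    moreover have "continuous_on A (\<lambda>z. z / q)"
      using q by (intro continuous_intros) auto
    ultimately have "continuous_on A (\<lambda>z. Arg2pi (z / q))"
      by (rule continuous_on_compose2) (use nonneg in blast)
    then show ?thesis
      unfolding h_def by (rule continuous_on_add[OF continuous_on_const])
  qed
  then have "connected (h ` A)" "compact (h ` A)"
    using A(1) \<open>compact A\<close> by (auto intro: connected_continuous_image compact_continuous_image)
  then obtain s t where st: "h ` A = {s..t}"
    using connected_compact_interval_1[of "h ` A"] by auto
  have "A = cis ` {s..t}"
    using cis_h unfolding st[symmetric] image_image by simp
  moreover have "s \<le> t"
    using st A(2) by (metis atLeastatMost_empty_iff2 image_is_empty)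
  moreover have "0 \<le> h z" "h z < 4 * pi" for z
    using Arg2pi[of q] Arg2pi[of "z / q"] by (auto simp: h_def \<theta>_def)
  then have "{s..t} \<subseteq> {0..<4 * pi}"
    unfolding st[symmetric] by auto
  ultimately show ?thesis
    using that[of s t] atLeastAtMost_iff[of s s t] atLeastAtMost_iff[of t s t]
    by (meson atLeastLessThan_iff order_refl subsetD)
qed

subsection \<open>Coding points by their position relative to the cut points\<close>

text \<open>The angles of the points of \<open>C\<close> form an interval. If it had length at least
  \<delta>, it would contain a multiple of \<delta>, that is, the angle of a net point.\<close>

lemma connected_avoiding_net_dist:
  assumes "\<delta> > 0" "connected C" "C \<subseteq> sphere 0 1" "u \<in> C" "v \<in> C"
    and avoid: "\<And>i::nat. real i * \<delta> < 2 * pi \<Longrightarrow> cis (real i * \<delta>) \<notin> C"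
  shows "dist u v < \<delta>"
proof -
  have Arg: "cis (Arg2pi z) = z" if "z \<in> C" for z
    using that assms(3) by (intro cis_Arg2pi) auto
  have less: "Arg2pi v < Arg2pi u + \<delta>" if "u \<in> C" "v \<in> C" for u v
  proof (rule ccontr)
    assume far: "\<not> Arg2pi v < Arg2pi u + \<delta>"
    have "continuous_on C Arg2pi"
    proof (intro continuous_at_imp_continuous_on ballI continuous_at_Arg2pi notI)
      \<comment> \<open>The net point with index 0 is 1, the only point of the circle on the branch
        cut of \<open>Arg2pi\<close>, so avoiding the net also makes \<open>Arg2pi\<close>
        continuous on \<open>C\<close>.\<close>
      fix z assume "z \<in> C" "z \<in> \<real>\<^sub>\<ge>\<^sub>0"
      then have "z = 1"
        using assms(3) by (auto elim!: nonneg_Reals_cases)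
      then show False
        using avoid[of 0] \<open>z \<in> C\<close> by simp
    qed
    then have "connected (Arg2pi ` C)"
      by (rule connected_continuous_image[OF _ assms(2)])
    then have ivl: "{Arg2pi u..Arg2pi v} \<subseteq> Arg2pi ` C"
      using connected_contains_Icc that by blast
    \<comment> \<open>This is the index of the first multiple of \<delta> not below the angle of
      \<open>u\<close>; it comes before the angle of \<open>v\<close>.\<close>
    define i where "i = nat \<lceil>Arg2pi u / \<delta>\<rceil>"
    have "0 \<le> \<lceil>Arg2pi u / \<delta>\<rceil>"
      using Arg2pi[of u] assms(1) by (simp add: divide_nonneg_pos less_le_trans[of "-1" 0])
    then have "real i = of_int \<lceil>Arg2pi u / \<delta>\<rceil>"
      by (simp add: i_def)
    then have "Arg2pi u / \<delta> \<le> real i" "real i < Arg2pi u / \<delta> + 1"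
      by linarith+
    then have "Arg2pi u \<le> real i * \<delta>" "real i * \<delta> < Arg2pi u + \<delta>"
      using assms(1) by (auto simp: field_simps)
    then have "real i * \<delta> \<in> Arg2pi ` C" "real i * \<delta> < 2 * pi"
      using ivl far Arg2pi[of v] by auto
    then show False
      using avoid Arg by fastforce
  qed
  have "dist u v \<le> \<bar>Arg2pi u - Arg2pi v\<bar>"
    using dist_cis_le[of "Arg2pi u" "Arg2pi v"] Arg assms by simp
  also have "\<dots> < \<delta>"
    using less[of u v] less[of v u] assms by auto
  finally show ?thesis .
qed

lemma monotone_code_avoiding:
  fixes P :: "real set"
  assumes "finite P"
  obtains \<kappa> :: "real \<Rightarrow> nat" where "mono \<kappa>" "\<And>t. \<kappa> t \<le> 2 * card P"
    "\<And>s t. \<lbrakk>s < t; \<kappa> s = \<kappa> t\<rbrakk> \<Longrightarrow> {s..t} \<inter> P = {}"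
proof
  \<comment> \<open>The value is twice the number of points of \<open>P\<close> below
    \<open>t\<close>, plus 1 if \<open>t\<close> is in \<open>P\<close>: gaps receive even codes and
    cut points odd ones.\<close>
  define \<kappa> where "\<kappa> = (\<lambda>t. card {p \<in> P. p < t} + card {p \<in> P. p \<le> t})"
  have fin: "finite {p \<in> P. Q p}" for Q
    using assms by simp
  show "mono \<kappa>"
    unfolding \<kappa>_def by (intro monoI add_mono card_mono fin) auto
  show "\<kappa> t \<le> 2 * card P" for t
  proof -
    have "card {p \<in> P. p < t} \<le> card P" "card {p \<in> P. p \<le> t} \<le> card P"
      using assms by (auto intro: card_mono)
    then show ?thesis
      by (simp add: \<kappa>_def)
  qed
  fix s t assume "s < t" and eq: "\<kappa> s = \<kappa> t"
  \<comment> \<open>Both counts are monotone in \<open>t\<close>, so equal sums force each count to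
    be equal.\<close>
  have le: "card {p \<in> P. p < s} \<le> card {p \<in> P. p < t}" "card {p \<in> P. p \<le> s} \<le> card {p \<in> P. p \<le> t}"
    using \<open>s < t\<close> by (auto intro!: card_mono fin)
  then have eqs: "card {p \<in> P. p < s} = card {p \<in> P. p < t}" "card {p \<in> P. p \<le> s} = card {p \<in> P. p \<le> t}"
    using eq by (auto simp: \<kappa>_def)
  have "{p \<in> P. p < s} = {p \<in> P. p < t}"
    by (rule card_subset_eq[OF fin _ eqs(1)]) (use \<open>s < t\<close> in auto)
  moreover have "{p \<in> P. p \<le> s} = {p \<in> P. p \<le> t}"
    by (rule card_subset_eq[OF fin _ eqs(2)]) (use \<open>s < t\<close> in auto)
  ultimately have "p < s" if "p \<in> P" "p \<le> t" for p
    using that \<open>s < t\<close> by (metis (mono_tags, lifting) mem_Collect_eq order_le_less)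
  then show "{s..t} \<inter> P = {}"
    by force
qed

text \<open>The factor 2 arises because a point of the circle has exactly two angles in [0, 4 pi),
  one turn apart.\<close>

lemma lifts_to_0_4pi:
  assumes "finite P"
  shows "finite {t \<in> {0..<4 * pi}. cis t \<in> P}" "card {t \<in> {0..<4 * pi}. cis t \<in> P} \<le> 2 * card P"
proof -
  have sub: "{t \<in> {0..<4 * pi}. cis t \<in> P} \<subseteq> Arg2pi ` P \<union> (\<lambda>p. Arg2pi p + 2 * pi) ` P"
  proof
    fix t assume t: "t \<in> {t \<in> {0..<4 * pi}. cis t \<in> P}"
    show "t \<in> Arg2pi ` P \<union> (\<lambda>p. Arg2pi p + 2 * pi) ` P"
    proof (cases "t < 2 * pi")
      case True
      then have "t = Arg2pi (cis t)"
        using t by (simp add: Arg2pi_cis)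
      then show ?thesis
        using t by blast
    next
      case False
      have "cis (t - 2 * pi) = cis t"
        using cis_add_2pi[of "t - 2 * pi"] by simp
      then have "t = Arg2pi (cis t) + 2 * pi"
        using t False Arg2pi_cis[of "t - 2 * pi"] by simp
      then show ?thesis
        using t by blast
    qed
  qed
  have fin: "finite (Arg2pi ` P \<union> (\<lambda>p. Arg2pi p + 2 * pi) ` P)"
    using assms by simp
  show "finite {t \<in> {0..<4 * pi}. cis t \<in> P}"
    using finite_subset[OF sub fin] .
  have "card {t \<in> {0..<4 * pi}. cis t \<in> P} \<le> card (Arg2pi ` P \<union> (\<lambda>p. Arg2pi p + 2 * pi) ` P)"
    by (rule card_mono[OF fin sub])
  also have "\<dots> \<le> card (Arg2pi ` P) + card ((\<lambda>p. Arg2pi p + 2 * pi) ` P)"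
    by (rule card_Un_le)
  also have "\<dots> \<le> card P + card P"
    using assms by (intro add_mono card_image_le)
  finally show "card {t \<in> {0..<4 * pi}. cis t \<in> P} \<le> 2 * card P"
    by simp
qed

text \<open>The cut points are the preimages, up to time \<open>n - 1\<close>, of a fixed finite net. An arc without
  cut points has small image at each of these times, since that image is connected and avoids the
  net. This is why every circle homeomorphism has at most linearly many distinguishable orbits.\<close>

lemma circle_orbit_coding:
  fixes f g :: "complex \<Rightarrow> complex"
  assumes hom: "homeomorphism (sphere 0 1) (sphere 0 1) f g" and "\<delta> > 0"
  obtains c :: nat where "\<And>n. \<exists>\<kappa> :: real \<Rightarrow> nat. mono \<kappa> \<and> (\<forall>t. \<kappa> t \<le> c * n) \<and>
    (\<forall>s\<in>{0..<4 * pi}. \<forall>t\<in>{0..<4 * pi}. \<kappa> s = \<kappa> t \<longrightarrow>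
      (\<forall>j<n. dist ((f ^^ j) (cis s)) ((f ^^ j) (cis t)) < \<delta>))"
proof
  define Q where "Q = {cis (real i * \<delta>) |i. real i * \<delta> < 2 * pi}"
  have "Q \<subseteq> (\<lambda>i. cis (real i * \<delta>)) ` {..nat \<lceil>2 * pi / \<delta>\<rceil>}"
  proof
    fix z assume "z \<in> Q"
    then obtain i where i: "z = cis (real i * \<delta>)" "real i * \<delta> < 2 * pi"
      by (auto simp: Q_def)
    then have "real i < 2 * pi / \<delta>"
      using \<open>\<delta> > 0\<close> by (simp add: field_simps)
    then have "i \<le> nat \<lceil>2 * pi / \<delta>\<rceil>"
      by linarith
    then show "z \<in> (\<lambda>i. cis (real i * \<delta>)) ` {..nat \<lceil>2 * pi / \<delta>\<rceil>}"
      using i by blast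
  qed
  then have "finite Q"
    using finite_surj by blast
  fix n
  define P where "P = (\<Union>j<n. (g ^^ j) ` Q)"
  have "finite P"
    using \<open>finite Q\<close> by (simp add: P_def)
  have "card P \<le> (\<Sum>j<n. card ((g ^^ j) ` Q))"
    unfolding P_def by (rule card_UN_le) simp
  also have "\<dots> \<le> (\<Sum>j<n. card Q)"
    using \<open>finite Q\<close> by (intro sum_mono card_image_le)
  finally have card_P: "card P \<le> n * card Q"
    by simp
  define P' where "P' = {t \<in> {0..<4 * pi}. cis t \<in> P}"
  have P': "finite P'" "card P' \<le> 2 * card P"
    using lifts_to_0_4pi[OF \<open>finite P\<close>] by (simp_all add: P'_def)
  obtain \<kappa> :: "real \<Rightarrow> nat" where \<kappa>: "mono \<kappa>" "\<And>t. \<kappa> t \<le> 2 * card P'"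
    "\<And>s t. \<lbrakk>s < t; \<kappa> s = \<kappa> t\<rbrakk> \<Longrightarrow> {s..t} \<inter> P' = {}"
    using monotone_code_avoiding[OF \<open>finite P'\<close>] by blast
  have near: "dist ((f ^^ j) (cis s)) ((f ^^ j) (cis t)) < \<delta>"
    if "0 \<le> s" "s < t" "t < 4 * pi" "\<kappa> s = \<kappa> t" "j < n" for s t j
  proof (rule connected_avoiding_net_dist[OF \<open>\<delta> > 0\<close>])
    have homj: "homeomorphism (sphere 0 1) (sphere 0 1) (f ^^ j) (g ^^ j)"
      by (rule homeomorphism_funpow[OF hom])
    let ?C = "(f ^^ j) ` cis ` {s..t}"
    have sub: "cis ` {s..t} \<subseteq> sphere 0 1"
      by auto
    show "connected ?C"
      using homj sub by (intro connected_continuous_image connected_cis_image)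
        (auto simp: homeomorphism_def intro: continuous_on_subset)
    show "?C \<subseteq> sphere 0 1"
      using homj sub unfolding homeomorphism_def by blast
    show "(f ^^ j) (cis s) \<in> ?C" "(f ^^ j) (cis t) \<in> ?C"
      using that by auto
    show "cis (real i * \<delta>) \<notin> ?C" if i: "real i * \<delta> < 2 * pi" for i
    proof
      assume "cis (real i * \<delta>) \<in> ?C"
      then obtain u where u: "u \<in> {s..t}" "cis (real i * \<delta>) = (f ^^ j) (cis u)"
        by auto
      then have "cis u = (g ^^ j) (cis (real i * \<delta>))"
        using homeomorphism_apply1[OF homj, of "cis u"] by simp
      then have "cis u \<in> P"
        using i \<open>j < n\<close> by (auto simp: P_def Q_def)
      then have "u \<in> {s..t} \<inter> P'"
        using u \<open>0 \<le> s\<close> \<open>t < 4 * pi\<close> by (auto simp: P'_def)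
      then show False
        using \<kappa>(3)[OF \<open>s < t\<close> \<open>\<kappa> s = \<kappa> t\<close>] by blast
    qed
  qed
  \<comment> \<open>One factor 2 in the constant comes from the two lifts of each cut point, the
    other from the two counts in the code. \<open>Q\<close> depends on \<delta> only, so the
    constant is uniform in \<open>n\<close>.\<close>
  show "\<exists>\<kappa> :: real \<Rightarrow> nat. mono \<kappa> \<and> (\<forall>t. \<kappa> t \<le> 4 * card Q * n) \<and>
    (\<forall>s\<in>{0..<4 * pi}. \<forall>t\<in>{0..<4 * pi}. \<kappa> s = \<kappa> t \<longrightarrow>
      (\<forall>j<n. dist ((f ^^ j) (cis s)) ((f ^^ j) (cis t)) < \<delta>))"
  proof (intro exI conjI ballI allI impI)
    show "\<kappa> t \<le> 4 * card Q * n" for t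
      using \<kappa>(2)[of t] P'(2) card_P by (simp add: mult.commute)
    fix s t j assume "s \<in> {0..<4 * pi}" "t \<in> {0..<4 * pi}" "\<kappa> s = \<kappa> t" "j < n"
    then show "dist ((f ^^ j) (cis s)) ((f ^^ j) (cis t)) < \<delta>"
      using near[of s t j] near[of t s j] \<open>\<delta> > 0\<close>
      by (cases s t rule: linorder_cases) (auto simp: dist_commute)
  qed (rule \<kappa>(1))
qed

subsection \<open>Upper bounds\<close>

text \<open>The partner of a point is chosen once for all times \<open>j < n\<close>, so the
  closeness of orbits passes to the images at each of these times.\<close>

lemma dyn_dist_image_less:
  assumes hom: "homeomorphism S S f g" and "n \<ge> 1" "0 < \<epsilon>" "A \<subseteq> S" "B \<subseteq> S"
    and "\<And>a. a \<in> A \<Longrightarrow> \<exists>b\<in>B. \<forall>j<n. dist ((f ^^ j) a) ((f ^^ j) b) < \<epsilon> / 2"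
    and "\<And>b. b \<in> B \<Longrightarrow> \<exists>a\<in>A. \<forall>j<n. dist ((f ^^ j) b) ((f ^^ j) a) < \<epsilon> / 2"
  shows "dyn_dist (hausdorff_dist S) (\<lambda>A. f ` A) n A B < \<epsilon>"
proof (rule dyn_dist_less[OF \<open>n \<ge> 1\<close>])
  fix j assume "j < n"
  have "homeomorphism S S (f ^^ j) (g ^^ j)"
    by (rule homeomorphism_funpow[OF hom])
  then have "(f ^^ j) ` A \<subseteq> S" "(f ^^ j) ` B \<subseteq> S"
    using assms(4,5) unfolding homeomorphism_def by blast+
  then have "hausdorff_dist S ((f ^^ j) ` A) ((f ^^ j) ` B) < \<epsilon>"
    by (rule hausdorff_dist_less[OF _ _ \<open>0 < \<epsilon>\<close>]) (use assms(6,7) \<open>j < n\<close> in blast)+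
  then show "hausdorff_dist S (((\<lambda>A. f ` A) ^^ j) A) (((\<lambda>A. f ` A) ^^ j) B) < \<epsilon>"
    by (simp add: funpow_image)
qed

text \<open>A set is coded by the set of codes of its points: equality of these finite sets gives
  each point of one set a partner with the same code in the other.\<close>

lemma circle_subset_coding:
  fixes f g :: "complex \<Rightarrow> complex"
  assumes hom: "homeomorphism (sphere 0 1) (sphere 0 1) f g" and "0 < \<epsilon>"
  obtains c :: nat where "\<And>n. n \<ge> 1 \<Longrightarrow> \<exists>\<iota> :: complex \<Rightarrow> nat. (\<forall>z. \<iota> z \<le> c * n) \<and>
    (\<forall>A B. A \<subseteq> sphere 0 1 \<longrightarrow> B \<subseteq> sphere 0 1 \<longrightarrow> \<iota> ` A = \<iota> ` B \<longrightarrow>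
      dyn_dist (hausdorff_dist (sphere 0 1)) (\<lambda>A. f ` A) n A B < \<epsilon>)"
proof -
  have "0 < \<epsilon> / 2"
    using \<open>0 < \<epsilon>\<close> by simp
  then obtain c :: nat where c: "\<And>n. \<exists>\<kappa> :: real \<Rightarrow> nat. mono \<kappa> \<and> (\<forall>t. \<kappa> t \<le> c * n) \<and>
    (\<forall>s\<in>{0..<4 * pi}. \<forall>t\<in>{0..<4 * pi}. \<kappa> s = \<kappa> t \<longrightarrow>
      (\<forall>j<n. dist ((f ^^ j) (cis s)) ((f ^^ j) (cis t)) < \<epsilon> / 2))"
    using circle_orbit_coding[OF hom] by blast
  show ?thesis
  proof (rule that)
    fix n :: nat assume "n \<ge> 1"
    obtain \<kappa> :: "real \<Rightarrow> nat" where \<kappa>: "\<And>t. \<kappa> t \<le> c * n"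
      and near: "\<And>s t j. \<lbrakk>s \<in> {0..<4 * pi}; t \<in> {0..<4 * pi}; \<kappa> s = \<kappa> t; j < n\<rbrakk> \<Longrightarrow>
        dist ((f ^^ j) (cis s)) ((f ^^ j) (cis t)) < \<epsilon> / 2"
      using c[of n] by blast
    define \<iota> where "\<iota> = (\<lambda>z. \<kappa> (Arg2pi z))"
    have Arg: "Arg2pi z \<in> {0..<4 * pi}" for z
      using Arg2pi[of z] by auto
    have near': "\<forall>j<n. dist ((f ^^ j) a) ((f ^^ j) b) < \<epsilon> / 2"
      if "a \<in> sphere 0 1" "b \<in> sphere 0 1" "\<iota> a = \<iota> b" for a b
      using near[OF Arg Arg, of a b] that by (simp add: \<iota>_def cis_Arg2pi)
    have "dyn_dist (hausdorff_dist (sphere 0 1)) (\<lambda>A. f ` A) n A B < \<epsilon>"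
      if AB: "A \<subseteq> sphere 0 1" "B \<subseteq> sphere 0 1" "\<iota> ` A = \<iota> ` B" for A B
    proof (rule dyn_dist_image_less[OF hom \<open>n \<ge> 1\<close> \<open>0 < \<epsilon>\<close> AB(1,2)])
      fix a assume "a \<in> A"
      then obtain b where "b \<in> B" "\<iota> a = \<iota> b"
        using AB(3) by (metis imageE imageI)
      then show "\<exists>b\<in>B. \<forall>j<n. dist ((f ^^ j) a) ((f ^^ j) b) < \<epsilon> / 2"
        using near' AB \<open>a \<in> A\<close> by blast
    next
      fix b assume "b \<in> B"
      then obtain a where "a \<in> A" "\<iota> b = \<iota> a"
        using AB(3) by (metis imageE imageI)
      then show "\<exists>a\<in>A. \<forall>j<n. dist ((f ^^ j) b) ((f ^^ j) a) < \<epsilon> / 2"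
        using near' AB \<open>b \<in> B\<close> by blast
    qed
    then show "\<exists>\<iota> :: complex \<Rightarrow> nat. (\<forall>z. \<iota> z \<le> c * n) \<and>
      (\<forall>A B. A \<subseteq> sphere 0 1 \<longrightarrow> B \<subseteq> sphere 0 1 \<longrightarrow> \<iota> ` A = \<iota> ` B \<longrightarrow>
        dyn_dist (hausdorff_dist (sphere 0 1)) (\<lambda>A. f ` A) n A B < \<epsilon>)"
      using \<kappa> by (intro exI[of _ \<iota>]) (auto simp: \<iota>_def)
  qed
qed

text \<open>\<open>y\<close> is \<open>x\<close> clamped to the second interval. If \<open>x\<close>
  falls short of \<open>s'\<close>, it lies between \<open>s\<close> and \<open>s'\<close>, and
  monotonicity squeezes its code to the common value; likewise beyond \<open>t'\<close>.\<close>

lemma mono_code_clamp: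
  fixes \<kappa> :: "real \<Rightarrow> nat"
  assumes "mono \<kappa>" "\<kappa> s = \<kappa> s'" "\<kappa> t = \<kappa> t'" "s' \<le> t'" "x \<in> {s..t}"
  obtains y where "y \<in> {s'..t'}" "\<kappa> x = \<kappa> y"
proof -
  consider "x < s'" | "s' \<le> x" "x \<le> t'" | "t' < x"
    by linarith
  then show ?thesis
  proof cases
    case 1
    then have "\<kappa> s \<le> \<kappa> x" "\<kappa> x \<le> \<kappa> s'"
      using assms(1,5) by (auto intro: monoD)
    then show ?thesis
      using that[of s'] assms by auto
  next
    case 2
    then show ?thesis
      using that[of x] by auto
  next
    case 3
    then have "\<kappa> t' \<le> \<kappa> x" "\<kappa> x \<le> \<kappa> t"
      using assms(1,5) by (auto intro: monoD)
    then show ?thesis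
      using that[of t'] assms by auto
  qed
qed

text \<open>The codes of the two end angles suffice: by clamping, equal end codes give every point
  of one arc a partner in the other. Hence quadratically many codes.\<close>

lemma circle_continuum_coding:
  fixes f g :: "complex \<Rightarrow> complex"
  assumes hom: "homeomorphism (sphere 0 1) (sphere 0 1) f g" and "0 < \<epsilon>"
  obtains c :: nat where "\<And>n. n \<ge> 1 \<Longrightarrow> \<exists>\<iota> :: complex set \<Rightarrow> nat \<times> nat.
    \<iota> ` continuum_hyperspace (sphere 0 1) \<subseteq> {..c * n} \<times> {..c * n} \<and>
    (\<forall>A\<in>continuum_hyperspace (sphere 0 1). \<forall>B\<in>continuum_hyperspace (sphere 0 1). \<iota> A = \<iota> B \<longrightarrow>
      dyn_dist (hausdorff_dist (sphere 0 1)) (\<lambda>A. f ` A) n A B < \<epsilon>)"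
proof -
  have "0 < \<epsilon> / 2"
    using \<open>0 < \<epsilon>\<close> by simp
  then obtain c :: nat where c: "\<And>n. \<exists>\<kappa> :: real \<Rightarrow> nat. mono \<kappa> \<and> (\<forall>t. \<kappa> t \<le> c * n) \<and>
    (\<forall>s\<in>{0..<4 * pi}. \<forall>t\<in>{0..<4 * pi}. \<kappa> s = \<kappa> t \<longrightarrow>
      (\<forall>j<n. dist ((f ^^ j) (cis s)) ((f ^^ j) (cis t)) < \<epsilon> / 2))"
    using circle_orbit_coding[OF hom] by blast
  \<comment> \<open>One pair of end angles per continuum is fixed here, before \<open>n\<close> is
    chosen.\<close>
  have "\<exists>s t. 0 \<le> s \<and> s \<le> t \<and> t < 4 * pi \<and> cis ` {s..t} = A"
    if "A \<in> continuum_hyperspace (sphere 0 1)" for A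
    by (rule continuum_eq_cis_image[OF that]) (intro exI conjI; simp)
  then obtain \<alpha> \<beta> where angles: "\<And>A. A \<in> continuum_hyperspace (sphere 0 1) \<Longrightarrow>
      0 \<le> \<alpha> A \<and> \<alpha> A \<le> \<beta> A \<and> \<beta> A < 4 * pi"
    and arc: "\<And>A. A \<in> continuum_hyperspace (sphere 0 1) \<Longrightarrow> cis ` {\<alpha> A..\<beta> A} = A"
    by metis
  show ?thesis
  proof (rule that)
    fix n :: nat assume "n \<ge> 1"
    obtain \<kappa> :: "real \<Rightarrow> nat" where \<kappa>: "mono \<kappa>" "\<And>t. \<kappa> t \<le> c * n"
      and near: "\<And>s t j. \<lbrakk>s \<in> {0..<4 * pi}; t \<in> {0..<4 * pi}; \<kappa> s = \<kappa> t; j < n\<rbrakk> \<Longrightarrow>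
        dist ((f ^^ j) (cis s)) ((f ^^ j) (cis t)) < \<epsilon> / 2"
      using c[of n] by blast
    have close: "\<exists>b\<in>B. \<forall>j<n. dist ((f ^^ j) a) ((f ^^ j) b) < \<epsilon> / 2"
      if AB: "A \<in> continuum_hyperspace (sphere 0 1)" "B \<in> continuum_hyperspace (sphere 0 1)"
        "\<kappa> (\<alpha> A) = \<kappa> (\<alpha> B)" "\<kappa> (\<beta> A) = \<kappa> (\<beta> B)" and "a \<in> A" for A B a
    proof -
      obtain x where x: "a = cis x" "x \<in> {\<alpha> A..\<beta> A}"
        using arc[OF AB(1)] \<open>a \<in> A\<close> by blast
      have "\<alpha> B \<le> \<beta> B"
        using angles[OF AB(2)] by blast
      then obtain y where y: "y \<in> {\<alpha> B..\<beta> B}" "\<kappa> x = \<kappa> y"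
        using mono_code_clamp[OF \<kappa>(1) AB(3,4) _ x(2)] by blast
      have "x \<in> {0..<4 * pi}" "y \<in> {0..<4 * pi}"
        using x y angles[OF AB(1)] angles[OF AB(2)] by auto
      then have "\<forall>j<n. dist ((f ^^ j) a) ((f ^^ j) (cis y)) < \<epsilon> / 2"
        using near y(2) x(1) by blast
      moreover have "cis y \<in> B"
        using arc[OF AB(2)] y(1) by blast
      ultimately show ?thesis
        by blast
    qed
    have sub: "A \<subseteq> sphere 0 1" if "A \<in> continuum_hyperspace (sphere 0 1)" for A :: "complex set"
      using that by (auto simp: continuum_hyperspace_def closed_hyperspace_def closedin_def)
    define \<iota> where "\<iota> = (\<lambda>A. (\<kappa> (\<alpha> A), \<kappa> (\<beta> A)))"
    have "dyn_dist (hausdorff_dist (sphere 0 1)) (\<lambda>A. f ` A) n A B < \<epsilon>"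
      if AB: "A \<in> continuum_hyperspace (sphere 0 1)" "B \<in> continuum_hyperspace (sphere 0 1)"
        and eq: "\<iota> A = \<iota> B" for A B
    proof (rule dyn_dist_image_less[OF hom \<open>n \<ge> 1\<close> \<open>0 < \<epsilon>\<close> sub[OF AB(1)] sub[OF AB(2)]])
      show "\<exists>b\<in>B. \<forall>j<n. dist ((f ^^ j) a) ((f ^^ j) b) < \<epsilon> / 2" if "a \<in> A" for a
        using close[OF AB] eq that by (simp add: \<iota>_def)
      show "\<exists>a\<in>A. \<forall>j<n. dist ((f ^^ j) b) ((f ^^ j) a) < \<epsilon> / 2" if "b \<in> B" for b
        using close[OF AB(2,1)] eq that by (simp add: \<iota>_def)
    qed
    then show "\<exists>\<iota> :: complex set \<Rightarrow> nat \<times> nat.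
      \<iota> ` continuum_hyperspace (sphere 0 1) \<subseteq> {..c * n} \<times> {..c * n} \<and>
      (\<forall>A\<in>continuum_hyperspace (sphere 0 1). \<forall>B\<in>continuum_hyperspace (sphere 0 1). \<iota> A = \<iota> B \<longrightarrow>
        dyn_dist (hausdorff_dist (sphere 0 1)) (\<lambda>A. f ` A) n A B < \<epsilon>)"
      using \<kappa>(2) by (intro exI[of _ \<iota>]) (auto simp: \<iota>_def)
  qed
qed

text \<open>A nonempty set with at most \<open>k\<close> elements is the set of entries of a list of
  length exactly \<open>k\<close>, obtained by repeating one of its elements.\<close>

lemma finite_subsets_card_le:
  assumes "finite K"
  shows "finite {B. B \<subseteq> K \<and> B \<noteq> {} \<and> card B \<le> k}"
    "card {B. B \<subseteq> K \<and> B \<noteq> {} \<and> card B \<le> k} \<le> card K ^ k"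
proof -
  let ?L = "{xs. set xs \<subseteq> K \<and> length xs = k}"
  have sub: "{B. B \<subseteq> K \<and> B \<noteq> {} \<and> card B \<le> k} \<subseteq> set ` ?L"
  proof
    fix B assume B: "B \<in> {B. B \<subseteq> K \<and> B \<noteq> {} \<and> card B \<le> k}"
    then obtain b where "b \<in> B"
      by blast
    obtain xs where xs: "set xs = B" "distinct xs"
      using finite_distinct_list[of B] B assms finite_subset by blast
    then have "length xs \<le> k"
      using B distinct_card by fastforce
    then have L: "xs @ replicate (k - length xs) b \<in> ?L"
      using xs B \<open>b \<in> B\<close> by (auto simp: set_replicate_conv_if)
    have eq: "set (xs @ replicate (k - length xs) b) = B"
      using xs \<open>b \<in> B\<close> by (auto simp: set_replicate_conv_if)
    show "B \<in> set ` ?L"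
      using imageI[OF L, of set] unfolding eq .
  qed
  have fin: "finite ?L"
    by (rule finite_lists_length_eq[OF assms])
  then show "finite {B. B \<subseteq> K \<and> B \<noteq> {} \<and> card B \<le> k}"
    using finite_surj[OF _ sub] by blast
  have "card {B. B \<subseteq> K \<and> B \<noteq> {} \<and> card B \<le> k} \<le> card (set ` ?L)"
    using fin sub by (intro card_mono) auto
  also have "\<dots> \<le> card ?L"
    by (rule card_image_le[OF fin])
  finally show "card {B. B \<subseteq> K \<and> B \<noteq> {} \<and> card B \<le> k} \<le> card K ^ k"
    by (simp add: card_lists_length_eq[OF assms])
qed

subsection \<open>Lower bounds\<close>

text \<open>For \<open>i > j\<close> the point is a forward iterate of \<open>p\<close>, which
  cannot return to \<open>U\<close>. For \<open>i < j\<close> it is a backward iterate; if it lay in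
  \<open>U\<close>, some iterate of \<open>f\<close> would carry it from \<open>U\<close> to
  \<open>p\<close> in \<open>U\<close>.\<close>

lemma wandering_orbit:
  assumes hom: "homeomorphism S S f g" and "p \<in> S" "wandering S f p"
  obtains U where "openin (top_of_set S) U" "p \<in> U"
    "\<And>i j. (f ^^ i) ((g ^^ j) p) \<in> U \<longleftrightarrow> i = j"
proof -
  obtain U where U: "openin (top_of_set S) U" "p \<in> U" "\<And>n. n \<ge> 1 \<Longrightarrow> (f ^^ n) ` U \<inter> U = {}"
    using assms(3) unfolding wandering_def by blast
  have inv: "(f ^^ n) ((g ^^ n) z) = z" "(g ^^ n) z \<in> S" if "z \<in> S" for n z
    using homeomorphism_funpow[OF hom, of n] that by (auto simp: homeomorphism_def)
  have fwd: "(f ^^ m) p \<notin> U" if "m \<ge> 1" for m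
    using U(2) U(3)[OF that] by blast
  have bwd: "(g ^^ m) p \<notin> U" if "m \<ge> 1" for m
    using U(2) U(3)[OF that] inv(1)[OF \<open>p \<in> S\<close>, of m] by (metis IntI empty_iff imageI)
  show ?thesis
  proof (rule that[OF U(1,2)])
    fix i j :: nat
    consider "i = j" | m where "j = i + m" "m \<ge> 1" | m where "i = m + j" "m \<ge> 1"
      by (metis Suc_leI add.commute less_imp_add_positive linorder_neqE_nat One_nat_def)
    then show "(f ^^ i) ((g ^^ j) p) \<in> U \<longleftrightarrow> i = j"
    proof cases
      case 1
      then show ?thesis
        using inv(1)[OF \<open>p \<in> S\<close>] U(2) by simp
    next
      case 2
      then have "(f ^^ i) ((g ^^ j) p) = (g ^^ m) p"
        using inv(1)[of "(g ^^ m) p" i] inv(2)[OF \<open>p \<in> S\<close>] by (simp add: funpow_add)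
      then show ?thesis
        using bwd 2 by simp
    next
      case 3
      then have "(f ^^ i) ((g ^^ j) p) = (f ^^ m) p"
        using inv(1)[OF \<open>p \<in> S\<close>] by (simp add: funpow_add)
      then show ?thesis
        using fwd 3 by simp
    qed
  qed
qed

lemma openin_contains_ball_Int:
  assumes "openin (top_of_set S) U" "p \<in> U"
  obtains r where "r > 0" "ball p r \<inter> S \<subseteq> U"
proof -
  have "\<exists>e>0. ball p e \<inter> S \<subseteq> U"
    using assms unfolding openin_contains_ball by simp
  then show ?thesis
    using that by blast
qed

lemma orbit_subsets_separated:
  assumes hom: "homeomorphism S S f g" and "bounded S" "p \<in> S"
    and ball: "ball p r \<inter> S \<subseteq> U"
    and orbit: "\<And>i j. (f ^^ i) ((g ^^ j) p) \<in> U \<longleftrightarrow> i = j"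
    and J: "J \<subseteq> {..<n}" "J' \<subseteq> {..<n}" "J \<noteq> {}" "J' \<noteq> {}" "J \<noteq> J'"
  shows "r \<le> dyn_dist (hausdorff_dist S) (\<lambda>A. f ` A) n ((\<lambda>j. (g ^^ j) p) ` J) ((\<lambda>j. (g ^^ j) p) ` J')"
proof -
  let ?x = "\<lambda>j. (g ^^ j) p"
  have homj: "homeomorphism S S (f ^^ j) (g ^^ j)" for j
    by (rule homeomorphism_funpow[OF hom])
  have "?x j \<in> S" for j
    using homj[of j] \<open>p \<in> S\<close> by (auto simp: homeomorphism_def)
  then have xS: "(f ^^ i) ` ?x ` I \<subseteq> S" for i I
    using homj[of i] by (auto simp: homeomorphism_def)
  have far: "r \<le> hausdorff_dist S ((f ^^ i) ` ?x ` I) ((f ^^ i) ` ?x ` I')"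
    if "i \<in> I" "i \<notin> I'" "I' \<noteq> {}" for i I I'
  proof (rule hausdorff_dist_ge[OF xS xS _ \<open>bounded S\<close>])
    have "(f ^^ i) (?x i) = p"
      using homj[of i] \<open>p \<in> S\<close> by (auto simp: homeomorphism_def)
    then show "p \<in> (f ^^ i) ` ?x ` I"
      using \<open>i \<in> I\<close> by (metis imageI)
    have "(f ^^ i) ` ?x ` I' \<inter> U = {}"
      using \<open>i \<notin> I'\<close> by (auto simp: orbit)
    then show "ball p r \<inter> (f ^^ i) ` ?x ` I' = {}"
      using ball xS[of i I'] by blast
  qed (use that in auto)
  \<comment> \<open>One of the two index sets may contain the other, so it is not known in advance
    which of them holds \<open>i\<close>.\<close>
  obtain i where "i < n" and i: "i \<in> J - J' \<or> i \<in> J' - J"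
    using J by blast
  from i have "r \<le> hausdorff_dist S ((f ^^ i) ` ?x ` J) ((f ^^ i) ` ?x ` J')"
  proof
    assume "i \<in> J - J'"
    then show ?thesis
      using far[of i J J'] J(4) by blast
  next
    assume "i \<in> J' - J"
    then show ?thesis
      using far[of i J' J] J(3) by (subst hausdorff_dist_commute) blast
  qed
  then show ?thesis
    using \<open>i < n\<close> by (intro le_dyn_dist[of i]) (simp_all add: funpow_image)
qed

section \<open>Connected sets and open sets relative to an arc\<close>

lemma connected_subset_arc_or_disjoint:
  assumes "connected C" "C \<subseteq> sphere 0 1" "s \<le> t" "t \<le> s + 2 * pi" "cis s \<notin> C" "cis t \<notin> C"
  shows "C \<subseteq> cis ` {s..t} \<or> C \<inter> cis ` {s..t} = {}"
proof -
  let ?A = "cis ` {s..t}" and ?B = "cis ` {t..s + 2 * pi}"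
  \<comment> \<open>The arc and its complementary closed arc meet in the endpoints only, and
    \<open>C\<close> avoids these. The two arcs thus cut \<open>C\<close> into disjoint closed
    pieces, one of which is empty.\<close>
  have "?A \<inter> ?B \<inter> C = {}"
  proof (rule ccontr)
    assume "?A \<inter> ?B \<inter> C \<noteq> {}"
    then obtain z where "z \<in> ?A" "z \<in> ?B" "z \<in> C"
      by blast
    then obtain v where v: "v \<in> {t..s + 2 * pi}" "cis v \<in> ?A" "cis v \<in> C"
      by (elim imageE[of z cis "{t..s + 2 * pi}"]) simp
    then have "v \<noteq> t" "v \<noteq> s + 2 * pi"
      using assms(5,6) by (auto simp: cis_add_2pi)
    then show False
      using cis_image_disjoint[OF v(2)] v(1) by auto
  qed
  moreover have "C \<subseteq> ?A \<union> ?B"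
    using cis_image_Un_complement[OF assms(3,4)] assms(2) by simp
  ultimately have "?A \<inter> C = {} \<or> ?B \<inter> C = {}"
    using connected_closedD[OF assms(1)] compact_cis_image compact_imp_closed by metis
  then show ?thesis
    using \<open>C \<subseteq> ?A \<union> ?B\<close> by blast
qed

text \<open>As the arc is shorter than a full turn, angles slightly beyond an end give points
  outside it, and these converge to the endpoint.\<close>

lemma arc_endpoints_not_interior:
  assumes "openin (top_of_set (sphere 0 1)) W" "W \<subseteq> cis ` {s..t}" "s \<le> t" "t < s + 2 * pi"
  shows "cis s \<notin> W" "cis t \<notin> W"
proof -
  obtain T where T: "open T" "W = sphere 0 1 \<inter> T"
    using assms(1) by (auto simp: openin_open)
  have outside: "cis u \<notin> T" if "t < u" "u < s + 2 * pi" for u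
  proof
    assume "cis u \<in> T"
    then have "cis u \<in> W"
      using T(2) by simp
    then show False
      using cis_image_disjoint[of u s t] assms(2) that by blast
  qed
  have lim: "(cis \<longlongrightarrow> cis a) (at a within X)" for a X
    by (intro tendsto_intros)
  show "cis t \<notin> W"
  proof
    assume "cis t \<in> W"
    then have "\<forall>\<^sub>F u in at_right t. cis u \<in> T"
      using T by (intro topological_tendstoD[OF lim]) auto
    moreover have "\<forall>\<^sub>F u in at_right t. u \<in> {t<..<s + 2 * pi}"
      using assms(4) by (rule eventually_at_right_real)
    ultimately have "\<forall>\<^sub>F u in at_right t. False"
      by eventually_elim (use outside in auto)
    then show False
      by simp
  qed
  show "cis s \<notin> W"
  proof
    assume "cis s \<in> W"
    then have "\<forall>\<^sub>F u in at_left s. cis u \<in> T"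
      using T by (intro topological_tendstoD[OF lim]) auto
    \<comment> \<open>This is the gap beyond \<open>t\<close>, seen one turn earlier.\<close>
    moreover have "\<forall>\<^sub>F u in at_left s. u \<in> {t - 2 * pi<..<s}"
      using assms(4) by (intro eventually_at_left_real) simp
    ultimately have "\<forall>\<^sub>F u in at_left s. False"
    proof eventually_elim
      case (elim u)
      then show False
        using outside[of "u + 2 * pi"] by (simp add: cis_add_2pi)
    qed
    then show False
      by simp
  qed
qed

text \<open>Neighbourhoods of \<open>p\<close> live at a later time, parametrised arcs at time 0.
  This moves their comparison back to time 0.\<close>

lemma image_disjoint_iff_homeomorphism:
  assumes "homeomorphism S S h h'" "V \<subseteq> S" "A \<subseteq> S"
  shows "h' ` V \<inter> A = {} \<longleftrightarrow> V \<inter> h ` A = {}" "h' ` V \<subseteq> A \<longleftrightarrow> V \<subseteq> h ` A"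
proof -
  have mem: "h' v \<in> A \<longleftrightarrow> v \<in> h ` A" if "v \<in> V" for v
  proof
    assume "h' v \<in> A"
    moreover have "v = h (h' v)"
      using assms(1,2) that by (simp add: homeomorphism_def subset_iff)
    ultimately show "v \<in> h ` A"
      by (rule image_eqI[rotated])
  next
    assume "v \<in> h ` A"
    then obtain a where "a \<in> A" "v = h a"
      by blast
    then show "h' v \<in> A"
      using homeomorphism_apply1[OF assms(1)] assms(3) by auto
  qed
  show "h' ` V \<inter> A = {} \<longleftrightarrow> V \<inter> h ` A = {}"
    using mem by blast
  show "h' ` V \<subseteq> A \<longleftrightarrow> V \<subseteq> h ` A"
    using mem by blast
qed

lemma homeomorphism_image_subset:
  assumes "homeomorphism S T h h'" "C \<subseteq> S"
  shows "h ` C \<subseteq> T" "connected C \<Longrightarrow> connected (h ` C)"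
proof -
  have "h ` S = T" "continuous_on S h"
    using assms(1) by (auto simp: homeomorphism_def)
  then show "h ` C \<subseteq> T" "connected C \<Longrightarrow> connected (h ` C)"
    using assms(2) by (blast intro: connected_continuous_image continuous_on_subset)+
qed

text \<open>The reason is that an arc leaves its endpoint on one side only.\<close>

lemma arc_image_misses_half_neighbourhood:
  fixes h h' :: "complex \<Rightarrow> complex"
  assumes hom: "homeomorphism (sphere 0 1) (sphere 0 1) h h'"
    and V: "openin (top_of_set (sphere 0 1)) V" "V = insert p (Vl \<union> Vr)" "p \<notin> Vl" "p \<notin> Vr"
    and conn: "connected Vl" "connected Vr"
    and st: "s \<le> t" "t < s + 2 * pi"
    and ends: "p \<in> h ` {cis s, cis t}" "h ` {cis s, cis t} \<inter> V \<subseteq> {p}"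
  shows "Vl \<inter> h ` cis ` {s..t} = {} \<or> Vr \<inter> h ` cis ` {s..t} = {}"
proof -
  let ?A = "cis ` {s..t}"
  have VS: "V \<subseteq> sphere 0 1" "Vl \<subseteq> sphere 0 1" "Vr \<subseteq> sphere 0 1" and AS: "?A \<subseteq> sphere 0 1"
    using openin_imp_subset[OF V(1)] V(2) by auto
  \<comment> \<open>A connected part of \<open>V\<close> without \<open>p\<close> pulls back to a
    connected set containing neither endpoint of the arc, so the arc contains it or misses
    it.\<close>
  have alt: "H \<subseteq> h ` ?A \<or> H \<inter> h ` ?A = {}" if "connected H" "H \<subseteq> V" "p \<notin> H" for H
  proof -
    have HS: "H \<subseteq> sphere 0 1"
      using that(2) VS by blast
    have endH: "e \<notin> h' ` H" if "e \<in> {cis s, cis t}" for e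
    proof
      assume "e \<in> h' ` H"
      then have "h e \<in> H"
        using hom HS by (auto simp: homeomorphism_def)
      then show False
        using ends(2) \<open>H \<subseteq> V\<close> \<open>p \<notin> H\<close> \<open>e \<in> {cis s, cis t}\<close> by blast
    qed
    have "connected (h' ` H)" "h' ` H \<subseteq> sphere 0 1"
      using homeomorphism_image_subset[OF homeomorphism_symD[OF hom] HS] that(1) by blast+
    then have "h' ` H \<subseteq> ?A \<or> h' ` H \<inter> ?A = {}"
      using connected_subset_arc_or_disjoint[of "h' ` H" s t] st endH by simp
    then show ?thesis
      using image_disjoint_iff_homeomorphism[OF hom HS AS] by simp
  qed
  \<comment> \<open>Otherwise all of \<open>V\<close> would be covered, and its pullback would be an
    open set inside the arc containing an endpoint.\<close>
  have "\<not> (Vl \<subseteq> h ` ?A \<and> Vr \<subseteq> h ` ?A)"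
  proof
    assume "Vl \<subseteq> h ` ?A \<and> Vr \<subseteq> h ` ?A"
    moreover have "p \<in> h ` ?A"
      using ends(1) st by auto
    ultimately have "V \<subseteq> h ` ?A"
      using V(2) by blast
    then have "h' ` V \<subseteq> ?A"
      using image_disjoint_iff_homeomorphism[OF hom VS(1) AS] by simp
    moreover have "openin (top_of_set (sphere 0 1)) (h' ` V)"
      using homeomorphism_imp_open_map[OF homeomorphism_symD[OF hom] V(1)] .
    ultimately have "cis s \<notin> h' ` V" "cis t \<notin> h' ` V"
      using arc_endpoints_not_interior st by blast+
    moreover have "cis s \<in> h' ` V \<or> cis t \<in> h' ` V"
      using ends(1) V(2) hom by (auto simp: homeomorphism_def)
    ultimately show False
      by blast
  qed
  then show ?thesis
    using alt[OF conn(1)] alt[OF conn(2)] V by blast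
qed

lemma cis_half_neighbourhoods:
  fixes p :: complex
  assumes "openin (top_of_set (sphere 0 1)) U" "p \<in> U"
  obtains V Vl Vr ul ur r where
    "V \<subseteq> U" "openin (top_of_set (sphere 0 1)) V" "V = insert p (Vl \<union> Vr)" "p \<notin> Vl" "p \<notin> Vr"
    "connected V" "connected Vl" "connected Vr" "0 < r"
    "ball p r \<inter> sphere 0 1 \<subseteq> V" "ul \<in> Vl" "ball ul r \<inter> sphere 0 1 \<subseteq> Vl"
    "ur \<in> Vr" "ball ur r \<inter> sphere 0 1 \<subseteq> Vr"
proof -
  obtain T where T: "open T" "U = sphere 0 1 \<inter> T"
    using assms(1) by (auto simp: openin_open)
  have p: "norm p = 1" "p \<in> T"
    using assms(2) T by auto
  define \<theta> where "\<theta> = Arg2pi p"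
  have p_eq: "p = cis \<theta>"
    using p by (simp add: \<theta>_def cis_Arg2pi)
  have "open (cis -` T)"
    using T(1) by (intro open_vimage continuous_intros)
  then obtain e where e: "e > 0" "ball \<theta> e \<subseteq> cis -` T"
    using p(2) p_eq open_contains_ball by (metis vimageI2)
  \<comment> \<open>The bound by \<open>e\<close> keeps the arc inside \<open>U\<close>; the bound
    by pi limits it to one turn, so that it is open and \<open>p\<close> lies in neither
    half.\<close>
  define \<eta> where "\<eta> = min e pi"
  have \<eta>: "0 < \<eta>" "\<eta> \<le> pi" "\<eta> \<le> e"
    using e pi_gt_zero by (auto simp: \<eta>_def)
  define V Vl Vr where "V = cis ` {\<theta> - \<eta><..<\<theta> + \<eta>}" and "Vl = cis ` {\<theta> - \<eta><..<\<theta>}"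
    and "Vr = cis ` {\<theta><..<\<theta> + \<eta>}"
  define ul ur where "ul = cis (\<theta> - \<eta> / 2)" and "ur = cis (\<theta> + \<eta> / 2)"
  have opens: "openin (top_of_set (sphere 0 1)) V" "openin (top_of_set (sphere 0 1)) Vl"
    "openin (top_of_set (sphere 0 1)) Vr"
    unfolding V_def Vl_def Vr_def using \<eta> by (auto intro: openin_cis_image)
  have mem: "p \<in> V" "ul \<in> Vl" "ur \<in> Vr"
    unfolding p_eq V_def Vl_def Vr_def ul_def ur_def using \<eta> by auto
  obtain r1 r2 r3 where r: "0 < r1" "ball p r1 \<inter> sphere 0 1 \<subseteq> V" "0 < r2" "ball ul r2 \<inter> sphere 0 1 \<subseteq> Vl"
    "0 < r3" "ball ur r3 \<inter> sphere 0 1 \<subseteq> Vr"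
    using openin_contains_ball_Int opens mem by meson
  define r where "r = min r1 (min r2 r3)"
  show ?thesis
  proof (rule that[of V Vl Vr r ul ur])
    have "{\<theta> - \<eta><..<\<theta> + \<eta>} \<subseteq> ball \<theta> e"
      using \<eta> by (auto simp: dist_real_def)
    then show "V \<subseteq> U"
      using e(2) T(2) by (auto simp: V_def)
    have "{\<theta> - \<eta><..<\<theta> + \<eta>} = insert \<theta> ({\<theta> - \<eta><..<\<theta>} \<union> {\<theta><..<\<theta> + \<eta>})"
      using \<eta> by auto
    then show "V = insert p (Vl \<union> Vr)"
      by (simp add: V_def Vl_def Vr_def p_eq image_Un)
    show "p \<notin> Vl" "p \<notin> Vr"
      unfolding p_eq Vl_def Vr_def using \<eta> by (auto dest!: cis_eq_imp_eq)
    show "connected V" "connected Vl" "connected Vr"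
      unfolding V_def Vl_def Vr_def by (auto intro: connected_cis_image)
    show "0 < r" "ball p r \<inter> sphere 0 1 \<subseteq> V" "ball ul r \<inter> sphere 0 1 \<subseteq> Vl" "ball ur r \<inter> sphere 0 1 \<subseteq> Vr"
      using r by (auto simp: r_def)
  qed (use opens mem in auto)
qed

text \<open>At time \<open>i\<close> the second image misses \<open>V\<close> or contains it. In the
  first case \<open>p\<close> is a point of the first image far from the second. In the second case
  the first image misses one half of \<open>V\<close>, and \<open>ul\<close> or \<open>ur\<close> is
  a point of the second image far from the first.\<close>

lemma orbit_arcs_separated:
  fixes f g :: "complex \<Rightarrow> complex"
  assumes hom: "homeomorphism (sphere 0 1) (sphere 0 1) f g" and p: "p \<in> sphere 0 1"
    and V: "openin (top_of_set (sphere 0 1)) V" "V = insert p (Vl \<union> Vr)" "p \<notin> Vl" "p \<notin> Vr"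
    and conn: "connected V" "connected Vl" "connected Vr"
    and balls: "ball p r \<inter> sphere 0 1 \<subseteq> V" "ul \<in> Vl" "ball ul r \<inter> sphere 0 1 \<subseteq> Vl"
      "ur \<in> Vr" "ball ur r \<inter> sphere 0 1 \<subseteq> Vr"
    and orbit: "\<And>i j. (f ^^ i) ((g ^^ j) p) \<in> V \<longleftrightarrow> i = j"
    and "i < n"
    and A: "s < t" "t < s + 2 * pi" "(g ^^ i) p \<in> {cis s, cis t}" "{cis s, cis t} \<subseteq> range (\<lambda>j. (g ^^ j) p)"
    and B: "s' < t'" "t' < s' + 2 * pi" "{cis s', cis t'} \<subseteq> (\<lambda>j. (g ^^ j) p) ` (- {i})"
  shows "r \<le> dyn_dist (hausdorff_dist (sphere 0 1)) (\<lambda>A. f ` A) n (cis ` {s..t}) (cis ` {s'..t'})"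
proof (rule le_dyn_dist[OF \<open>i < n\<close>])
  let ?h = "f ^^ i" and ?h' = "g ^^ i"
  let ?A = "cis ` {s..t}" and ?B = "cis ` {s'..t'}"
  have homi: "homeomorphism (sphere 0 1) (sphere 0 1) ?h ?h'"
    by (rule homeomorphism_funpow[OF hom])
  have VS: "V \<subseteq> sphere 0 1"
    using openin_imp_subset[OF V(1)] .
  have S: "?A \<subseteq> sphere 0 1" "?B \<subseteq> sphere 0 1"
    by auto
  then have hS: "?h ` ?A \<subseteq> sphere 0 1" "?h ` ?B \<subseteq> sphere 0 1"
    using homeomorphism_image_subset(1)[OF homi] by blast+
  have hp: "?h (?h' p) = p"
    using homi p by (auto simp: homeomorphism_def)
  have pA: "p \<in> ?h ` {cis s, cis t}"
    using A(3) hp by (metis imageI)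
  have "z = p" if z: "z \<in> ?h ` {cis s, cis t} \<inter> V" for z
  proof -
    obtain e where e: "z = ?h e" "e \<in> {cis s, cis t}"
      by (rule imageE[OF IntD1[OF z]])
    obtain j where "e = (g ^^ j) p"
      by (rule rangeE[OF subsetD[OF A(4) e(2)]])
    then show ?thesis
      using e(1) IntD2[OF z] orbit hp by metis
  qed
  then have "?h ` {cis s, cis t} \<inter> V \<subseteq> {p}"
    by blast
  then have half: "Vl \<inter> ?h ` ?A = {} \<or> Vr \<inter> ?h ` ?A = {}"
    using A(1,2) by (intro arc_image_misses_half_neighbourhood[OF homi V conn(2,3) _ _ pA]) auto
  have out: "e \<notin> ?h' ` V" if e: "e \<in> {cis s', cis t'}" for e
  proof
    assume "e \<in> ?h' ` V"
    then have "?h e \<in> V"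
      using homi VS by (auto simp: homeomorphism_def)
    moreover obtain j where "e = (g ^^ j) p" "j \<in> - {i}"
      by (rule imageE[OF subsetD[OF B(3) e]])
    ultimately show False
      using orbit by auto
  qed
  have "connected (?h' ` V)" "?h' ` V \<subseteq> sphere 0 1"
    using homeomorphism_image_subset[OF homeomorphism_symD[OF homi] VS] conn(1) by blast+
  then have "?h' ` V \<subseteq> ?B \<or> ?h' ` V \<inter> ?B = {}"
    using connected_subset_arc_or_disjoint[of "?h' ` V" s' t'] B(1,2) out by simp
  then have alt: "V \<subseteq> ?h ` ?B \<or> V \<inter> ?h ` ?B = {}"
    using image_disjoint_iff_homeomorphism[OF homi VS S(2)] by simp
  have bnd: "bounded (sphere (0::complex) 1)"
    by simp
  have ne: "?h ` ?A \<noteq> {}" "?h ` ?B \<noteq> {}"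
    using A(1) B(1) by auto
  have "r \<le> hausdorff_dist (sphere 0 1) (?h ` ?A) (?h ` ?B)"
    using alt
  proof
    assume "V \<inter> ?h ` ?B = {}"
    then have "ball p r \<inter> ?h ` ?B = {}"
      using balls(1) hS(2) by blast
    moreover have "p \<in> ?h ` ?A"
      using pA A(1) by auto
    ultimately show ?thesis
      by (intro hausdorff_dist_ge[OF hS ne(2) bnd])
  next
    assume sub: "V \<subseteq> ?h ` ?B"
    obtain u where "u \<in> V" "ball u r \<inter> ?h ` ?A = {}"
      using half balls hS(1) V(2) by blast
    then have "r \<le> hausdorff_dist (sphere 0 1) (?h ` ?B) (?h ` ?A)"
      using sub by (intro hausdorff_dist_ge[OF hS(2,1) ne(1) bnd]) auto
    then show ?thesis
      by (simp add: hausdorff_dist_commute)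
  qed
  then show "r \<le> hausdorff_dist (sphere 0 1) (((\<lambda>A. f ` A) ^^ i) ?A) (((\<lambda>A. f ` A) ^^ i) ?B)"
    by (simp add: funpow_image)
qed

subsection \<open>Polynomial entropy of the induced maps\<close>

text \<open>Of the two arcs between the points, the one from the smaller to the larger
  \<open>Arg2pi\<close> is taken; its length is automatically below 2 pi.\<close>

lemma orbit_pair_arc:
  fixes p :: complex and g :: "complex \<Rightarrow> complex"
  assumes "\<And>j. (g ^^ j) p \<in> sphere 0 1" "inj (\<lambda>j. (g ^^ j) p)" "card J = 2"
  shows "\<exists>s t. s < t \<and> t < s + 2 * pi \<and> {cis s, cis t} = (\<lambda>j. (g ^^ j) p) ` J"
proof -
  let ?x = "\<lambda>j. (g ^^ j) p"
  have *: ?thesis if ij: "J = {i, j}" "Arg2pi (?x i) < Arg2pi (?x j)" for i j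
  proof (intro exI conjI)
    show "Arg2pi (?x i) < Arg2pi (?x j)"
      by (rule ij(2))
    show "Arg2pi (?x j) < Arg2pi (?x i) + 2 * pi"
      using Arg2pi[of "?x i"] Arg2pi[of "?x j"] by linarith
    show "{cis (Arg2pi (?x i)), cis (Arg2pi (?x j))} = ?x ` J"
      using assms(1) by (simp add: ij(1) cis_Arg2pi)
  qed
  obtain i j where ij: "J = {i, j}" "i \<noteq> j"
    using assms(3) by (auto simp: card_2_iff)
  have "cis (Arg2pi (?x i)) \<noteq> cis (Arg2pi (?x j))"
    using assms(1) injD[OF assms(2), of i j] ij(2) by (auto simp: cis_Arg2pi)
  then have "Arg2pi (?x i) \<noteq> Arg2pi (?x j)"
    by auto
  then show ?thesis
  proof (rule linorder_neqE)
    assume "Arg2pi (?x i) < Arg2pi (?x j)"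
    with ij(1) show ?thesis
      by (rule *)
  next
    assume less: "Arg2pi (?x j) < Arg2pi (?x i)"
    have "J = {j, i}"
      using ij(1) by blast
    then show ?thesis
      using less by (rule *)
  qed
qed

text \<open>This puts the estimate (n/k)^k for the binomial coefficient into the form required by
  \<open>pol_entropy_polynomial\<close>.\<close>

lemma binomial_ge_power:
  assumes "k \<ge> 1" "k \<le> n"
  shows "(1 / real k) ^ k * real n ^ k \<le> real (n choose k)"
  using binomial_ge_n_over_k_pow_k[OF assms(2), where 'a = real]
  by (simp add: power_divide)

context
  fixes f g :: "complex \<Rightarrow> complex" and p :: complex
  assumes hom: "homeomorphism (sphere 0 1) (sphere 0 1) f g"
    and p: "p \<in> sphere 0 1" "wandering (sphere 0 1) f p"
begin

lemma pol_entropy_continuum_hyperspace: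
  "pol_entropy (continuum_hyperspace (sphere 0 1)) (hausdorff_dist (sphere 0 1)) (\<lambda>A. f ` A) = 2"
proof -
  let ?x = "\<lambda>j. (g ^^ j) p" and ?S = "sphere 0 1 :: complex set"
  let ?d = "hausdorff_dist ?S" and ?F = "\<lambda>A. f ` A"
  obtain U where U: "openin (top_of_set ?S) U" "p \<in> U"
    and orbitU: "\<And>i j. (f ^^ i) (?x j) \<in> U \<longleftrightarrow> i = j"
    using wandering_orbit[OF hom p] by blast
  obtain V Vl Vr ul ur r where "V \<subseteq> U"
    and V: "openin (top_of_set ?S) V" "V = insert p (Vl \<union> Vr)" "p \<notin> Vl" "p \<notin> Vr"
    and conn: "connected V" "connected Vl" "connected Vr" and "0 < r"
    and balls: "ball p r \<inter> ?S \<subseteq> V" "ul \<in> Vl" "ball ul r \<inter> ?S \<subseteq> Vl" "ur \<in> Vr" "ball ur r \<inter> ?S \<subseteq> Vr"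
    using cis_half_neighbourhoods[OF U] by metis
  have homj: "homeomorphism ?S ?S (f ^^ j) (g ^^ j)" for j
    by (rule homeomorphism_funpow[OF hom])
  have xS: "?x j \<in> ?S" for j
    using homeomorphism_image_subset(1)[OF homeomorphism_symD[OF homj[of j]] order_refl] p(1) by blast
  have orbit: "(f ^^ i) (?x j) \<in> V \<longleftrightarrow> i = j" for i j
  proof
    show "i = j" if "(f ^^ i) (?x j) \<in> V"
      using orbitU that \<open>V \<subseteq> U\<close> by blast
    show "(f ^^ i) (?x j) \<in> V" if "i = j"
      using homeomorphism_apply2[OF homj p(1)] that V(2) by simp
  qed
  have "inj ?x"
  proof (rule injI)
    fix i j assume "?x i = ?x j"
    then have "(f ^^ i) (?x j) \<in> V"
      using orbit[of i i] by simp
    then show "i = j"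
      by (simp add: orbit)
  qed
  define L where "L n = {J. J \<subseteq> {..<n::nat} \<and> card J = 2}" for n
  have L: "finite (L n)" "card (L n) = n choose 2" for n
    using n_subsets[of "{..<n}" 2] by (simp_all add: L_def)
  obtain \<sigma> \<tau> where \<sigma>\<tau>: "\<And>J. card J = 2 \<Longrightarrow> \<sigma> J < \<tau> J \<and> \<tau> J < \<sigma> J + 2 * pi"
    and ends: "\<And>J. card J = 2 \<Longrightarrow> {cis (\<sigma> J), cis (\<tau> J)} = ?x ` J"
    using orbit_pair_arc[OF xS \<open>inj ?x\<close>] by metis
  define arc where "arc J = cis ` {\<sigma> J..\<tau> J}" for J
  have arc_mem: "arc J \<in> continuum_hyperspace ?S" if "card J = 2" for J
  proof -
    have "closedin (top_of_set ?S) (arc J)"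
      unfolding arc_def by (rule closed_subset) (auto simp: compact_cis_image compact_imp_closed)
    moreover have "connected (arc J)"
      unfolding arc_def by (rule connected_cis_image) simp
    moreover have "arc J \<noteq> {}"
      using \<sigma>\<tau>[OF that] by (simp add: arc_def)
    ultimately show ?thesis
      by (simp add: continuum_hyperspace_def closed_hyperspace_def)
  qed
  have sep: "r \<le> dyn_dist ?d ?F n (arc J) (arc J')" if J: "J \<in> L n" "J' \<in> L n" "J \<noteq> J'" for n J J'
  proof -
    have card2: "card J = 2" "card J' = 2" and fin: "finite J" "finite J'"
      using J by (auto simp: L_def intro: finite_subset)
    \<comment> \<open>Distinct sets of equal finite size are not nested, so the index can be taken
      in \<open>J\<close>, as the asymmetric roles in \<open>orbit_arcs_separated\<close>
      demand.\<close>
    have "\<not> J \<subseteq> J'"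
      using card_subset_eq[OF fin(2)] card2 J(3) by auto
    then obtain i where i: "i \<in> J" "i \<notin> J'"
      by blast
    show ?thesis
      unfolding arc_def
    proof (rule orbit_arcs_separated[OF hom p(1) V conn balls orbit])
      show "i < n"
        using i J by (auto simp: L_def)
      show "?x i \<in> {cis (\<sigma> J), cis (\<tau> J)}" "{cis (\<sigma> J), cis (\<tau> J)} \<subseteq> range ?x"
        "{cis (\<sigma> J'), cis (\<tau> J')} \<subseteq> ?x ` (- {i})"
        unfolding ends[OF card2(1)] ends[OF card2(2)] using i by auto
    qed (use \<sigma>\<tau> card2 in auto)
  qed
  have "pol_entropy (continuum_hyperspace ?S) ?d ?F = ereal (real 2)"
  proof (rule pol_entropy_polynomial[OF \<open>0 < r\<close>])
    fix \<epsilon> :: real assume \<epsilon>: "0 < \<epsilon>" "\<epsilon> < r"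
    obtain c :: nat where c: "\<And>n. n \<ge> 1 \<Longrightarrow> \<exists>\<iota> :: complex set \<Rightarrow> nat \<times> nat.
      \<iota> ` continuum_hyperspace ?S \<subseteq> {..c * n} \<times> {..c * n} \<and>
      (\<forall>A\<in>continuum_hyperspace ?S. \<forall>B\<in>continuum_hyperspace ?S. \<iota> A = \<iota> B \<longrightarrow> dyn_dist ?d ?F n A B < \<epsilon>)"
      using circle_continuum_coding[OF hom \<epsilon>(1)] by blast
    have "(1 / 2) ^ 2 * real n ^ 2 \<le> max_separated (continuum_hyperspace ?S) ?d ?F n \<epsilon> \<and>
        max_separated (continuum_hyperspace ?S) ?d ?F n \<epsilon> \<le> real (c + 1) ^ 2 * real n ^ 2" if "n \<ge> 2" for n
    proof
      obtain \<iota> :: "complex set \<Rightarrow> nat \<times> nat" where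
        \<iota>: "\<iota> ` continuum_hyperspace ?S \<subseteq> {..c * n} \<times> {..c * n}"
        and code: "\<And>A B. \<lbrakk>A \<in> continuum_hyperspace ?S; B \<in> continuum_hyperspace ?S; \<iota> A = \<iota> B\<rbrakk> \<Longrightarrow>
          dyn_dist ?d ?F n A B < \<epsilon>"
        using c[of n] \<open>n \<ge> 2\<close> by (metis One_nat_def Suc_1 Suc_leD)
      have fin: "finite ({..c * n} \<times> {..c * n})"
        by simp
      have "max_separated (continuum_hyperspace ?S) ?d ?F n \<epsilon> \<le> card ({..c * n} \<times> {..c * n})"
        by (rule max_separated_le_codes[OF fin \<iota> code])
      also have "\<dots> = (c * n + 1) ^ 2"
        by (simp add: power2_eq_square)
      \<comment> \<open>The summand 1 is absorbed by \<open>n\<close>, leaving a constant multiple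
        of \<open>n ^ 2\<close>.\<close>
      also have "\<dots> \<le> ((c + 1) * n) ^ 2"
        using that by (intro power_mono) (auto simp: algebra_simps)
      finally have "max_separated (continuum_hyperspace ?S) ?d ?F n \<epsilon> \<le> ((c + 1) * n) ^ 2" .
      then have "real (max_separated (continuum_hyperspace ?S) ?d ?F n \<epsilon>) \<le> real (((c + 1) * n) ^ 2)"
        by (rule of_nat_mono)
      then show "real (max_separated (continuum_hyperspace ?S) ?d ?F n \<epsilon>) \<le> real (c + 1) ^ 2 * real n ^ 2"
        by (simp only: of_nat_power of_nat_mult power_mult_distrib)
      have "card (L n) \<le> max_separated (continuum_hyperspace ?S) ?d ?F n \<epsilon>"
      proof (rule card_le_max_separated[OF fin \<iota> code L(1)])
        show "arc ` L n \<subseteq> continuum_hyperspace ?S"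
          using arc_mem by (auto simp: L_def)
        show "\<epsilon> \<le> dyn_dist ?d ?F n (arc J) (arc J')" if "J \<in> L n" "J' \<in> L n" "J \<noteq> J'" for J J'
          using sep[OF that] \<epsilon>(2) by simp
      qed
      then have "real (n choose 2) \<le> max_separated (continuum_hyperspace ?S) ?d ?F n \<epsilon>"
        unfolding L(2) by (rule of_nat_mono)
      then show "(1 / 2) ^ 2 * real n ^ 2 \<le> max_separated (continuum_hyperspace ?S) ?d ?F n \<epsilon>"
        using binomial_ge_power[of 2 n] that by simp
    qed
    then show "\<exists>a b::real. 0 < a \<and>
      (\<forall>\<^sub>F n in sequentially. a * real n ^ 2 \<le> max_separated (continuum_hyperspace ?S) ?d ?F n \<epsilon> \<and>
        max_separated (continuum_hyperspace ?S) ?d ?F n \<epsilon> \<le> b * real n ^ 2)"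
      using eventually_sequentiallyI[of 2]
      by (intro exI[of _ "(1 / 2) ^ 2"] exI[of _ "real (c + 1) ^ 2"]) simp
  qed
  then show ?thesis
    by simp
qed

lemma pol_entropy_finite_hyperspace:
  assumes "k \<ge> 1"
  shows "pol_entropy (finite_hyperspace k (sphere 0 1)) (hausdorff_dist (sphere 0 1)) (\<lambda>A. f ` A) = ereal (real k)"
proof -
  let ?x = "\<lambda>j. (g ^^ j) p" and ?S = "sphere 0 1 :: complex set"
  let ?Z = "finite_hyperspace k ?S" and ?d = "hausdorff_dist ?S" and ?F = "\<lambda>A. f ` A"
  obtain U where U: "openin (top_of_set ?S) U" "p \<in> U"
    and orbit: "\<And>i j. (f ^^ i) (?x j) \<in> U \<longleftrightarrow> i = j"
    using wandering_orbit[OF hom p] by blast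
  obtain r where r: "0 < r" "ball p r \<inter> ?S \<subseteq> U"
    using openin_contains_ball_Int[OF U] by blast
  have xS: "?x j \<in> ?S" for j
    using homeomorphism_image_subset(1)[OF homeomorphism_symD[OF homeomorphism_funpow[OF hom, of j]] order_refl] p(1)
    by blast
  define L where "L n = {J. J \<subseteq> {..<n::nat} \<and> card J = k}" for n
  have L: "finite (L n)" "card (L n) = n choose k" for n
    using n_subsets[of "{..<n}" k] by (simp_all add: L_def)
  have L_mem: "J \<subseteq> {..<n}" "J \<noteq> {}" "(`) ?x J \<in> ?Z" if "J \<in> L n" for J n
  proof -
    show "J \<subseteq> {..<n}" "J \<noteq> {}"
      using that assms by (auto simp: L_def)
    moreover have "finite J"
      using \<open>J \<subseteq> {..<n}\<close> finite_subset by blast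
    ultimately show "(`) ?x J \<in> ?Z"
      using that xS card_image_le[of J ?x] by (auto simp: finite_hyperspace_def L_def)
  qed
  have bnd: "bounded ?S"
    by simp
  show ?thesis
  proof (rule pol_entropy_polynomial[OF r(1)])
    fix \<epsilon> :: real assume \<epsilon>: "0 < \<epsilon>" "\<epsilon> < r"
    obtain c :: nat where c: "\<And>n. n \<ge> 1 \<Longrightarrow> \<exists>\<iota> :: complex \<Rightarrow> nat. (\<forall>z. \<iota> z \<le> c * n) \<and>
      (\<forall>A B. A \<subseteq> ?S \<longrightarrow> B \<subseteq> ?S \<longrightarrow> \<iota> ` A = \<iota> ` B \<longrightarrow> dyn_dist ?d ?F n A B < \<epsilon>)"
      using circle_subset_coding[OF hom \<epsilon>(1)] by blast
    have "(1 / real k) ^ k * real n ^ k \<le> max_separated ?Z ?d ?F n \<epsilon> \<and>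
        max_separated ?Z ?d ?F n \<epsilon> \<le> real (c + 1) ^ k * real n ^ k" if "n \<ge> k" for n
    proof
      have "n \<ge> 1"
        using that assms by simp
      then obtain \<iota> :: "complex \<Rightarrow> nat" where \<iota>: "\<And>z. \<iota> z \<le> c * n"
        and code: "\<And>A B. \<lbrakk>A \<subseteq> ?S; B \<subseteq> ?S; \<iota> ` A = \<iota> ` B\<rbrakk> \<Longrightarrow> dyn_dist ?d ?F n A B < \<epsilon>"
        using c[of n] by blast
      let ?K = "{B. B \<subseteq> {..c * n} \<and> B \<noteq> {} \<and> card B \<le> k}"
      have fin: "finite ?K" and card_K: "card ?K \<le> (c * n + 1) ^ k"
        using finite_subsets_card_le[of "{..c * n}" k] by simp_all
      \<comment> \<open>Passing to codes does not increase cardinality, so a set with at most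
        \<open>k\<close> points has at most \<open>k\<close> codes.\<close>
      have K: "(`) \<iota> ` ?Z \<subseteq> ?K"
      proof (intro subsetI, elim imageE)
        fix B A assume B: "B = \<iota> ` A" and A: "A \<in> ?Z"
        then have "card B \<le> card A"
          by (auto simp: finite_hyperspace_def intro: card_image_le)
        then show "B \<in> ?K"
          using A \<iota> by (auto simp: B finite_hyperspace_def)
      qed
      have code': "dyn_dist ?d ?F n A B < \<epsilon>" if "A \<in> ?Z" "B \<in> ?Z" "(`) \<iota> A = (`) \<iota> B" for A B
        using that by (intro code) (auto simp: finite_hyperspace_def)
      have "max_separated ?Z ?d ?F n \<epsilon> \<le> card ?K"
        by (rule max_separated_le_codes[OF fin K code'])
      also have "\<dots> \<le> ((c + 1) * n) ^ k"
        using card_K \<open>n \<ge> 1\<close> by (elim order_trans, intro power_mono) (auto simp: algebra_simps)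
      finally have "real (max_separated ?Z ?d ?F n \<epsilon>) \<le> real (((c + 1) * n) ^ k)"
        by (rule of_nat_mono)
      then show "real (max_separated ?Z ?d ?F n \<epsilon>) \<le> real (c + 1) ^ k * real n ^ k"
        by (simp only: of_nat_power of_nat_mult power_mult_distrib)
      have "card (L n) \<le> max_separated ?Z ?d ?F n \<epsilon>"
      proof (rule card_le_max_separated[OF fin K code' L(1)])
        show "(`) ?x ` L n \<subseteq> ?Z"
          using L_mem(3) by blast
        show "\<epsilon> \<le> dyn_dist ?d ?F n (?x ` J) (?x ` J')" if J: "J \<in> L n" "J' \<in> L n" "J \<noteq> J'" for J J'
          using orbit_subsets_separated[OF hom bnd p(1) r(2) orbit L_mem(1)[OF J(1)] L_mem(1)[OF J(2)]
              L_mem(2)[OF J(1)] L_mem(2)[OF J(2)] J(3)] \<epsilon>(2) by simp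
      qed
      then have "real (n choose k) \<le> max_separated ?Z ?d ?F n \<epsilon>"
        unfolding L(2) by (rule of_nat_mono)
      then show "(1 / real k) ^ k * real n ^ k \<le> max_separated ?Z ?d ?F n \<epsilon>"
        using binomial_ge_power[OF assms that] by simp
    qed
    then show "\<exists>a b::real. 0 < a \<and>
      (\<forall>\<^sub>F n in sequentially. a * real n ^ k \<le> max_separated ?Z ?d ?F n \<epsilon> \<and>
        max_separated ?Z ?d ?F n \<epsilon> \<le> b * real n ^ k)"
      using eventually_sequentiallyI[of k] assms
      by (intro exI[of _ "(1 / real k) ^ k"] exI[of _ "real (c + 1) ^ k"]) simp
  qed
qed

lemma pol_entropy_closed_hyperspace:
  "pol_entropy (closed_hyperspace (sphere 0 1)) (hausdorff_dist (sphere 0 1)) (\<lambda>A. f ` A) = \<infinity>"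
proof -
  let ?x = "\<lambda>j. (g ^^ j) p" and ?S = "sphere 0 1 :: complex set"
  let ?Z = "closed_hyperspace ?S" and ?d = "hausdorff_dist ?S" and ?F = "\<lambda>A. f ` A"
  obtain U where U: "openin (top_of_set ?S) U" "p \<in> U"
    and orbit: "\<And>i j. (f ^^ i) (?x j) \<in> U \<longleftrightarrow> i = j"
    using wandering_orbit[OF hom p] by blast
  obtain r where r: "0 < r" "ball p r \<inter> ?S \<subseteq> U"
    using openin_contains_ball_Int[OF U] by blast
  have xS: "?x j \<in> ?S" for j
    using homeomorphism_image_subset(1)[OF homeomorphism_symD[OF homeomorphism_funpow[OF hom, of j]] order_refl] p(1)
    by blast
  define L where "L n = Pow {..<n::nat} - {{}}" for n
  have L: "finite (L n)" "card (L n) = 2 ^ n - 1" for n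
    by (simp_all add: L_def card_Diff_subset card_Pow)
  have L_mem: "J \<subseteq> {..<n}" "J \<noteq> {}" "(`) ?x J \<in> ?Z" if "J \<in> L n" for J n
  proof -
    show "J \<subseteq> {..<n}" "J \<noteq> {}"
      using that by (auto simp: L_def)
    then have "finite J"
      using finite_subset by blast
    then have "closedin (top_of_set ?S) (?x ` J)"
      using xS by (intro closed_subset finite_imp_closed) auto
    then show "(`) ?x J \<in> ?Z"
      using \<open>J \<noteq> {}\<close> by (simp add: closed_hyperspace_def)
  qed
  have bnd: "bounded ?S"
    by simp
  show ?thesis
  proof (rule pol_entropy_exponential[OF r(1)])
    fix \<epsilon> :: real assume \<epsilon>: "0 < \<epsilon>" "\<epsilon> < r"
    obtain c :: nat where c: "\<And>n. n \<ge> 1 \<Longrightarrow> \<exists>\<iota> :: complex \<Rightarrow> nat. (\<forall>z. \<iota> z \<le> c * n) \<and>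
      (\<forall>A B. A \<subseteq> ?S \<longrightarrow> B \<subseteq> ?S \<longrightarrow> \<iota> ` A = \<iota> ` B \<longrightarrow> dyn_dist ?d ?F n A B < \<epsilon>)"
      using circle_subset_coding[OF hom \<epsilon>(1)] by blast
    have "2 ^ n - 1 \<le> max_separated ?Z ?d ?F n \<epsilon>" if n: "n \<ge> 1" for n
    proof -
      obtain \<iota> :: "complex \<Rightarrow> nat" where \<iota>: "\<And>z. \<iota> z \<le> c * n"
        and code: "\<And>A B. \<lbrakk>A \<subseteq> ?S; B \<subseteq> ?S; \<iota> ` A = \<iota> ` B\<rbrakk> \<Longrightarrow> dyn_dist ?d ?F n A B < \<epsilon>"
        using c[OF n] by blast
      \<comment> \<open>There are exponentially many codes here; they only ensure that the maximum
        is over a finite set.\<close>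
      have K: "finite (Pow {..c * n})" "(`) \<iota> ` ?Z \<subseteq> Pow {..c * n}"
        using \<iota> by auto
      have code': "dyn_dist ?d ?F n A B < \<epsilon>" if "A \<in> ?Z" "B \<in> ?Z" "(`) \<iota> A = (`) \<iota> B" for A B
        by (rule code) (use that in \<open>auto simp: closed_hyperspace_def dest!: closedin_imp_subset\<close>)
      have "card (L n) \<le> max_separated ?Z ?d ?F n \<epsilon>"
      proof (rule card_le_max_separated[OF K code' L(1)])
        show "(`) ?x ` L n \<subseteq> ?Z"
          using L_mem(3) by blast
        show "\<epsilon> \<le> dyn_dist ?d ?F n (?x ` J) (?x ` J')" if J: "J \<in> L n" "J' \<in> L n" "J \<noteq> J'" for J J'
          using orbit_subsets_separated[OF hom bnd p(1) r(2) orbit L_mem(1)[OF J(1)] L_mem(1)[OF J(2)]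
              L_mem(2)[OF J(1)] L_mem(2)[OF J(2)] J(3)] \<epsilon>(2) by simp
      qed
      then show ?thesis
        by (simp add: L(2))
    qed
    then show "\<forall>\<^sub>F n in sequentially. 2 ^ n - 1 \<le> max_separated ?Z ?d ?F n \<epsilon>"
      by (rule eventually_sequentiallyI)
  qed
qed

end

lemma infinite_circle: "infinite (sphere (0::complex) 1)"
proof
  assume "finite (sphere (0::complex) 1)"
  then have "finite (cis ` {0..<2 * pi})"
    using circle_eq_cis_image[of 0] by simp
  moreover have "inj_on cis {0..<2 * pi}"
    by (rule inj_onI, rule cis_eq_imp_eq) auto
  ultimately have "finite {0..<2 * pi}"
    by (rule finite_imageD)
  then show False
    by (simp add: infinite_Ico)
qed

theorem theoremB:
  fixes f g :: "complex \<Rightarrow> complex"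
  defines "S1 \<equiv> sphere (0::complex) 1"
  assumes "homeomorphism S1 S1 f g"
    and "finite (nonwandering_set S1 f)"
  shows "pol_entropy (continuum_hyperspace S1) (hausdorff_dist S1) (\<lambda>A. f ` A) = 2
    \<and> (\<forall>k::nat. k \<ge> 1 \<longrightarrow>
         pol_entropy (finite_hyperspace k S1) (hausdorff_dist S1) (\<lambda>A. f ` A) = ereal (real k))
    \<and> pol_entropy (closed_hyperspace S1) (hausdorff_dist S1) (\<lambda>A. f ` A) = \<infinity>"
proof -
  \<comment> \<open>A finite non-wandering set cannot exhaust the infinite circle.\<close>
  obtain p where "p \<in> S1" "p \<notin> nonwandering_set S1 f"
    using infinite_circle assms(3) unfolding S1_def by (meson finite_subset subsetI)
  then have "wandering S1 f p"
    by (simp add: nonwandering_set_def)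
  then show ?thesis
    using pol_entropy_continuum_hyperspace pol_entropy_finite_hyperspace pol_entropy_closed_hyperspace
      assms(2) \<open>p \<in> S1\<close> unfolding S1_def by blast
qed

end
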